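(* Let $a,b,e\in\Bbbk^\times$ satisfy $ae\ne b^2=(ae)^{-1}$, and suppose that $b$ is a primitive $n$-th root of unity for some $n\ge 5$. Then $\dim\mathfrak{B}(V_{abe})=\infty$.
   Context: $\Bbbk$ is an algebraically closed field of characteristic $0$. $V_{abe}=\Bbbk v_1\oplus\Bbbk v_2$ is the two-dimensional braided vector space with braiding $c(v_1\otimes v_1)=a\,v_2\otimes v_2$, $c(v_1\otimes v_2)=b\,v_1\otimes v_2$, $c(v_2\otimes v_1)=b\,v_2\otimes v_1$, $c(v_2\otimes v_2)=e\,v_1\otimes v_1$. $\mathfrak{B}(V_{abe})$ denotes the Nichols algebra of $(V_{abe},c)$. *)

theory Defs
  imports
    "HOL-Algebra.Embedded_Algebras"
    "HOL-Algebra.QuotRing"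
    "HOL-Combinatorics.Permutations"
    "HOL-Computational_Algebra.Polynomial"
begin

section \<open>Tensor algebra of a based vector space\<close>

text \<open>
  \<open>V\<close> has the basis \<open>(x\<^sub>i)\<close> indexed by a finite type \<open>'i\<close>. The word \<open>[i\<^sub>1, \<dots>, i\<^sub>m]\<close> stands for
  \<open>x\<^sub>i\<^sub>1 \<otimes> \<dots> \<otimes> x\<^sub>i\<^sub>m\<close>, and a tensor is given by its finitely supported coefficient function on words.
\<close>

definition tensor_algebra :: "('i list \<Rightarrow> 'k::field) ring" where
  "tensor_algebra =
    \<lparr>carrier = {f. finite {w. f w \<noteq> 0}},
     monoid.mult = (\<lambda>f g w. \<Sum>k\<le>length w. f (take k w) * g (drop k w)),
     one = (\<lambda>w. if w = [] then 1 else 0),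
     zero = (\<lambda>w. 0),
     add = (\<lambda>f g w. f w + g w)\<rparr>"

definition scalar_tensor :: "'k::field \<Rightarrow> 'i list \<Rightarrow> 'k" where
  "scalar_tensor z = (\<lambda>w. if w = [] then z else 0)"

definition tensor_component :: "nat \<Rightarrow> ('i list \<Rightarrow> 'k::field) \<Rightarrow> 'i list \<Rightarrow> 'k" where
  "tensor_component m f = (\<lambda>w. if length w = m then f w else 0)"

section \<open>Braidings and quantum symmetrizers\<close>

text \<open>
  A linear map \<open>c\<close> on \<open>V \<otimes> V\<close> is given by its matrix \<open>C\<close>:
  \<open>c (x\<^sub>i \<otimes> x\<^sub>j) = (\<Sum>k l. C (i, j) (k, l) \<cdot> x\<^sub>k \<otimes> x\<^sub>l)\<close>.
\<close>

type_synonym ('i, 'k) braiding = "'i \<times> 'i \<Rightarrow> 'i \<times> 'i \<Rightarrow> 'k"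

text \<open>
  The action of \<open>c\<close> on the tensor factors \<open>p\<close> and \<open>p + 1\<close> (counted from \<open>0\<close>) of tensors of
  degree at least \<open>p + 2\<close>, read off on coefficient functions.
\<close>

definition braid_at :: "('i::finite, 'k::field) braiding \<Rightarrow> nat \<Rightarrow> ('i list \<Rightarrow> 'k) \<Rightarrow> 'i list \<Rightarrow> 'k" where
  "braid_at C p f = (\<lambda>w.
     if Suc p < length w
     then \<Sum>(i, j)\<in>UNIV. C (i, j) (w ! p, w ! Suc p) * f (w[p := i, Suc p := j])
     else f w)"

definition braid_equation :: "('i::finite, 'k::field) braiding \<Rightarrow> bool" where
  "braid_equation C \<longleftrightarrow>
    (\<forall>f w. length w = 3 \<longrightarrow>
      braid_at C 0 (braid_at C 1 (braid_at C 0 f)) w = braid_at C 1 (braid_at C 0 (braid_at C 1 f)) w)"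

text \<open>
  A reduced expression of a permutation \<open>\<sigma>\<close> of \<open>{0, \<dots>, m - 1}\<close> in the simple transpositions
  \<open>s\<^sub>p = (p, p + 1)\<close>: with \<open>L\<^sub>k\<close> the \<open>k\<close>-th entry of the Lehmer code of \<open>\<sigma>\<close>, it is the product over
  \<open>k = 0, \<dots>, m - 1\<close> of the blocks \<open>s\<^bsub>k + L\<^sub>k - 1\<^esub> \<dots> s\<^bsub>k + 1\<^esub> s\<^sub>k\<close>. By Matsumoto's theorem the lift
  of \<open>\<sigma>\<close> to the braid group does not depend on the reduced expression.
\<close>

definition lehmer :: "nat \<Rightarrow> (nat \<Rightarrow> nat) \<Rightarrow> nat \<Rightarrow> nat" where
  "lehmer m \<sigma> k = card {l \<in> {k<..<m}. \<sigma> l < \<sigma> k}"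

definition reduced_word :: "nat \<Rightarrow> (nat \<Rightarrow> nat) \<Rightarrow> nat list" where
  "reduced_word m \<sigma> = concat (map (\<lambda>k. rev [k..<k + lehmer m \<sigma> k]) [0..<m])"

definition word_perm :: "nat list \<Rightarrow> nat \<Rightarrow> nat" where
  "word_perm ps = foldr (\<lambda>p \<tau>. transpose p (Suc p) \<circ> \<tau>) ps id"

lemma word_perm_Nil [simp]: "word_perm [] = id"
  by (simp add: word_perm_def)

lemma word_perm_Cons [simp]: "word_perm (p # ps) = transpose p (Suc p) \<circ> word_perm ps"
  by (simp add: word_perm_def)

lemma word_perm_append: "word_perm (ps @ qs) = word_perm ps \<circ> word_perm qs"
  by (induction ps) (simp_all add: o_assoc)

lemma word_perm_block:
  "word_perm (rev [k..<k + L]) j =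
    (if j = k then k + L else if k < j \<and> j \<le> k + L then j - 1 else j)"
proof (induction L)
  case 0
  then show ?case by auto
next
  case (Suc L)
  then show ?case by (auto simp: transpose_def)
qed

lemma lehmer_fix:
  assumes "\<sigma> permutes {..<m}" "k < m" "\<forall>i<k. \<sigma> i = i"
  shows "\<sigma> k = k + lehmer m \<sigma> k"
proof -
  have inj: "inj \<sigma>" using assms(1) by (rule permutes_inj)
  have ge: "k \<le> \<sigma> i" if "k \<le> i" for i
  proof (rule ccontr)
    assume "\<not> k \<le> \<sigma> i"
    then have "\<sigma> (\<sigma> i) = \<sigma> i" using assms(3) by simp
    then have "\<sigma> i = i" using inj by (simp add: inj_eq)
    then show False using \<open>\<not> k \<le> \<sigma> i\<close> that by simp
  qed
  have "\<sigma> ` {l \<in> {k<..<m}. \<sigma> l < \<sigma> k} = {k..<\<sigma> k}"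
  proof (intro equalityI subsetI)
    fix y assume "y \<in> \<sigma> ` {l \<in> {k<..<m}. \<sigma> l < \<sigma> k}"
    then show "y \<in> {k..<\<sigma> k}" using ge by auto
  next
    fix y assume y: "y \<in> {k..<\<sigma> k}"
    obtain l where l: "y = \<sigma> l" using permutes_surj[OF assms(1)] by (metis surjD)
    have "\<sigma> k < m" using assms(1,2) permutes_in_image by fastforce
    then have "l < m" using y l permutes_in_image[OF assms(1), of l] by auto
    moreover have "k < l" using y l assms(3) by (metis atLeastLessThan_iff le_less_trans nat_neq_iff not_le)
    ultimately show "y \<in> \<sigma> ` {l \<in> {k<..<m}. \<sigma> l < \<sigma> k}" using y l by auto
  qed
  then have "lehmer m \<sigma> k = card {k..<\<sigma> k}"
    unfolding lehmer_def using card_image[OF inj_on_subset[OF inj subset_UNIV]] by metis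
  then show ?thesis using ge[of k] by simp
qed

lemma word_perm_reduced_word_aux:
  assumes "\<sigma> permutes {..<m}" "k \<le> m" "\<forall>i<k. \<sigma> i = i"
  shows "word_perm (concat (map (\<lambda>k. rev [k..<k + lehmer m \<sigma> k]) [k..<m])) = \<sigma>"
  using assms
proof (induction "m - k" arbitrary: k \<sigma>)
  case 0
  then have "m = k" by simp
  have "\<sigma> x = x" for x
    using 0 \<open>m = k\<close> permutes_not_in[OF 0(2), of x] by (cases "x < k") auto
  then have "\<sigma> = id" by auto
  then show ?case using 0 by simp
next
  case (Suc d)
  then have km: "k < m" by simp
  define L where "L = lehmer m \<sigma> k"
  define \<gamma> where "\<gamma> = word_perm (rev [k..<k + L])"
  have \<gamma>: "\<gamma> j = (if j = k then k + L else if k < j \<and> j \<le> k + L then j - 1 else j)" for j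
    unfolding \<gamma>_def by (rule word_perm_block)
  have \<sigma>k: "\<sigma> k = k + L" unfolding L_def using Suc.prems km by (intro lehmer_fix) auto
  have kL: "k + L < m" using \<sigma>k km permutes_in_image[OF Suc.prems(1), of k] by simp
  define \<delta> where "\<delta> j = (if j = k + L then k else if k \<le> j \<and> j < k + L then Suc j else j)" for j
  have \<gamma>\<delta>: "\<gamma> (\<delta> j) = j" and \<delta>\<gamma>: "\<delta> (\<gamma> j) = j" for j
    by (auto simp: \<gamma> \<delta>_def)
  have "bij \<delta>" using \<gamma>\<delta> \<delta>\<gamma> by (intro o_bij[of \<gamma>]) auto
  then have \<delta>p: "\<delta> permutes {..<m}"
    unfolding permutes_def bij_iff using kL by (auto simp: \<delta>_def)
  define \<sigma>' where "\<sigma>' = \<delta> \<circ> \<sigma>"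
  have \<sigma>'p: "\<sigma>' permutes {..<m}" unfolding \<sigma>'_def using Suc.prems(1) \<delta>p by (rule permutes_compose)
  have fix': "\<forall>i<Suc k. \<sigma>' i = i"
    using Suc.prems(3) \<sigma>k by (auto simp: \<sigma>'_def \<delta>_def less_Suc_eq)
  have mono: "\<sigma>' i < \<sigma>' j \<longleftrightarrow> \<sigma> i < \<sigma> j" if "k < i" "k < j" for i j
  proof -
    have "\<sigma> i \<noteq> k + L" "\<sigma> j \<noteq> k + L"
      using \<sigma>k that permutes_inj[OF Suc.prems(1)] by (metis injD nat_neq_iff)+
    then show ?thesis by (auto simp: \<sigma>'_def \<delta>_def)
  qed
  have "lehmer m \<sigma>' j = lehmer m \<sigma> j" if "k < j" for j
    unfolding lehmer_def using that mono by (intro arg_cong[where f = card]) auto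
  then have "map (\<lambda>k. rev [k..<k + lehmer m \<sigma> k]) [Suc k..<m] = map (\<lambda>k. rev [k..<k + lehmer m \<sigma>' k]) [Suc k..<m]"
    by simp
  moreover have "word_perm (concat (map (\<lambda>k. rev [k..<k + lehmer m \<sigma>' k]) [Suc k..<m])) = \<sigma>'"
    using Suc.hyps(2) km by (intro Suc.hyps(1) \<sigma>'p fix') auto
  ultimately have "word_perm (concat (map (\<lambda>k. rev [k..<k + lehmer m \<sigma> k]) [k..<m])) = \<gamma> \<circ> \<sigma>'"
    using km by (simp only: upt_conv_Cons list.map concat.simps word_perm_append \<gamma>_def L_def)
  also have "\<dots> = \<sigma>" by (auto simp: \<sigma>'_def \<gamma>\<delta> fun_eq_iff)
  finally show ?case .
qed

lemma word_perm_reduced_word: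
  "\<sigma> permutes {..<m} \<Longrightarrow> word_perm (reduced_word m \<sigma>) = \<sigma>"
  unfolding reduced_word_def by (rule word_perm_reduced_word_aux) auto

lemma length_reduced_word:
  "length (reduced_word m \<sigma>) = card {(k, l). k < l \<and> l < m \<and> \<sigma> l < \<sigma> k}"
proof -
  have "{(k, l). k < l \<and> l < m \<and> \<sigma> l < \<sigma> k} = (SIGMA k:{..<m}. {l \<in> {k<..<m}. \<sigma> l < \<sigma> k})"
    by auto
  then have "card {(k, l). k < l \<and> l < m \<and> \<sigma> l < \<sigma> k} = (\<Sum>k<m. lehmer m \<sigma> k)"
    by (simp add: lehmer_def)
  then show ?thesis
    by (simp add: reduced_word_def length_concat comp_def interv_sum_list_conv_sum_set_nat atLeast0LessThan)
qed

definition braid_lift ::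
  "('i::finite, 'k::field) braiding \<Rightarrow> nat \<Rightarrow> (nat \<Rightarrow> nat) \<Rightarrow> ('i list \<Rightarrow> 'k) \<Rightarrow> 'i list \<Rightarrow> 'k" where
  "braid_lift C m \<sigma> f = foldr (braid_at C) (reduced_word m \<sigma>) f"

definition quantum_symmetrizer ::
  "('i::finite, 'k::field) braiding \<Rightarrow> nat \<Rightarrow> ('i list \<Rightarrow> 'k) \<Rightarrow> 'i list \<Rightarrow> 'k" where
  "quantum_symmetrizer C m f = (\<lambda>w. \<Sum>\<sigma> | \<sigma> permutes {..<m}. braid_lift C m \<sigma> f w)"

section \<open>Nichols algebras\<close>

text \<open>The ideal \<open>\<J>(V)\<close>, the direct sum over \<open>m\<close> of the kernels of the quantum symmetrizers on \<open>V\<^sup>\<otimes>\<^sup>m\<close>.\<close>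

definition nichols_ideal :: "('i::finite, 'k::field) braiding \<Rightarrow> ('i list \<Rightarrow> 'k) set" where
  "nichols_ideal C = {f \<in> carrier tensor_algebra.
     \<forall>m. quantum_symmetrizer C m (tensor_component m f) = (\<lambda>w. 0)}"

definition nichols_algebra :: "('i::finite, 'k::field) braiding \<Rightarrow> ('i list \<Rightarrow> 'k) set ring" where
  "nichols_algebra C = tensor_algebra Quot nichols_ideal C"

text \<open>The copy of the ground field inside the Nichols algebra.\<close>

definition nichols_scalars :: "('i::finite, 'k::field) braiding \<Rightarrow> ('i list \<Rightarrow> 'k) set set" where
  "nichols_scalars C = range (\<lambda>z. nichols_ideal C +>\<^bsub>tensor_algebra\<^esub> scalar_tensor z)"

definition nichols_infinite_dimensional :: "('i::finite, 'k::field) braiding \<Rightarrow> bool" where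
  "nichols_infinite_dimensional C \<longleftrightarrow>
     ring.infinite_dimension (nichols_algebra C) (nichols_scalars C) (carrier (nichols_algebra C))"

section \<open>The braided vector space \<open>V\<^sub>a\<^sub>b\<^sub>e\<close>\<close>

datatype idx = V1 | V2

lemma UNIV_idx: "UNIV = {V1, V2}"
  using idx.exhaust by blast

instance idx :: finite
  by standard (simp add: UNIV_idx)

fun V_abe :: "'k::field \<Rightarrow> 'k \<Rightarrow> 'k \<Rightarrow> (idx, 'k) braiding" where
  "V_abe a b e (V1, V1) kl = (if kl = (V2, V2) then a else 0)"
| "V_abe a b e (V1, V2) kl = (if kl = (V1, V2) then b else 0)"
| "V_abe a b e (V2, V1) kl = (if kl = (V2, V1) then b else 0)"
| "V_abe a b e (V2, V2) kl = (if kl = (V1, V1) then e else 0)"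

lemma braid_equation_V_abe: "braid_equation (V_abe a b e)"
proof -
  have U: "(UNIV :: (idx \<times> idx) set) = {(V1, V1), (V1, V2), (V2, V1), (V2, V2)}"
    unfolding UNIV_Times_UNIV[symmetric] UNIV_idx by auto
  have "braid_at (V_abe a b e) 0 (braid_at (V_abe a b e) 1 (braid_at (V_abe a b e) 0 f)) [x, y, z] =
        braid_at (V_abe a b e) 1 (braid_at (V_abe a b e) 0 (braid_at (V_abe a b e) 1 f)) [x, y, z]" for f x y z
    by (cases x; cases y; cases z) (simp_all add: braid_at_def U)
  then show ?thesis
    unfolding braid_equation_def by (auto simp: numeral_3_eq_3 length_Suc_conv)
qed

definition primitive_root_of_unity :: "nat \<Rightarrow> 'k::field \<Rightarrow> bool" where
  "primitive_root_of_unity n z \<longleftrightarrow> 0 < n \<and> z ^ n = 1 \<and> (\<forall>k. 0 < k \<and> k < n \<longrightarrow> z ^ k \<noteq> 1)"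

end

theory Submission
  imports Defs "HOL-Library.Function_Algebras"
begin

text \<open>
  Flipping every second tensor factor and rescaling \<open>v\<^sub>2\<close> conjugates the braiding of \<open>V\<^sub>a\<^sub>b\<^sub>e\<close> to the
  diagonal braiding with \<open>q\<^sub>1\<^sub>1 = q\<^sub>2\<^sub>2 = b\<close> and \<open>q\<^sub>1\<^sub>2 = q\<^sub>2\<^sub>1 = b\<^sup>-\<^sup>1\<close>, of affine Cartan type
  \<open>A\<^sub>1\<^sup>(\<^sup>1\<^sup>)\<close>. The quantum symmetrizer of a diagonal braiding is the homomorphism from the tensor algebra to the
  quantum shuffle algebra that is the identity on letters, so it suffices to find nonzero shuffle polynomials
  of arbitrarily large degree. With \<open>\<delta> = xy - b\<^sup>-\<^sup>1yx\<close> these are the real root vectors \<open>R\<^sub>0 = x\<close>,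
  \<open>R\<^sub>n\<^sub>+\<^sub>1 = [\<delta>, R\<^sub>n]\<close>. The left skew derivative \<open>A\<^sub>n\<close> of \<open>R\<^sub>n\<close> by \<open>x\<close> is an imaginary root vector, and
  it commutes with \<open>\<delta>\<close>; hence, up to a factor, the derivative of \<open>A\<^sub>n\<^sub>+\<^sub>1\<close> by \<open>x\<close> is
  \<open>b\<^sup>-\<^sup>1yA\<^sub>n - bA\<^sub>ny\<close>, and the coefficient of \<open>x(xy)\<^sup>n\<close> in \<open>R\<^sub>n\<close> is \<open>((1 - b\<^sup>-\<^sup>2)(b\<^sup>-\<^sup>1 - b))\<^sup>n\<close>,
  which is nonzero because \<open>b\<^sup>2 \<noteq> 1\<close>.
\<close>

section \<open>Left derivatives of functions on words\<close>

definition lderiv :: "'i \<Rightarrow> ('i list \<Rightarrow> 'k) \<Rightarrow> 'i list \<Rightarrow> 'k" where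
  "lderiv i f = (\<lambda>w. f (i # w))"

definition letter :: "'i \<Rightarrow> 'i list \<Rightarrow> 'k::field" where
  "letter i = (\<lambda>w. if w = [i] then 1 else 0)"

definition scl :: "'k::field \<Rightarrow> ('i list \<Rightarrow> 'k) \<Rightarrow> 'i list \<Rightarrow> 'k" where
  "scl c f = (\<lambda>w. c * f w)"

text \<open>A word is empty or starts with a letter, so the value at \<open>[]\<close> and the left
  derivatives determine a function. Identities thus reduce to identities of lower degree.\<close>

lemma eq_by_lderiv: "f [] = g [] \<Longrightarrow> (\<And>i. lderiv i f = lderiv i g) \<Longrightarrow> f = g"
  by (metis (no_types) ext lderiv_def list.exhaust)

lemma lderiv_simps [simp]:
  "lderiv i (f + g) = lderiv i f + lderiv i g"
  "lderiv i (f - g) = lderiv i f - lderiv i g"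
  "lderiv i (- f) = - lderiv i f"
  "lderiv i 0 = 0"
  "lderiv i (scl c f) = scl c (lderiv i f)"
  "lderiv i (scalar_tensor z) = 0"
  "lderiv i (letter j) = (if i = j then scalar_tensor 1 else 0)"
  by (auto simp: lderiv_def scl_def scalar_tensor_def letter_def fun_eq_iff)

lemma letter_Nil [simp]: "letter i [] = 0"
  by (simp add: letter_def)

lemma scl_apply [simp]: "scl c f w = c * f w"
  by (simp add: scl_def)

section \<open>The tensor algebra\<close>

definition tmult :: "('i list \<Rightarrow> 'k::field) \<Rightarrow> ('i list \<Rightarrow> 'k) \<Rightarrow> 'i list \<Rightarrow> 'k" where
  "tmult f g = (\<lambda>w. \<Sum>k\<le>length w. f (take k w) * g (drop k w))"

lemma tensor_algebra_simps:
  "carrier tensor_algebra = {f. finite {w. f w \<noteq> 0}}"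
  "x \<otimes>\<^bsub>tensor_algebra\<^esub> y = tmult x y"
  "\<one>\<^bsub>tensor_algebra\<^esub> = scalar_tensor 1"
  "\<zero>\<^bsub>tensor_algebra\<^esub> = 0"
  "x \<oplus>\<^bsub>tensor_algebra\<^esub> y = x + y"
  by (auto simp: tensor_algebra_def tmult_def scalar_tensor_def)

lemma tmult_Nil [simp]: "tmult f g [] = f [] * g []"
  by (simp add: tmult_def)

lemma tmult_Cons: "tmult f g (i # w) = f [] * g (i # w) + tmult (lderiv i f) g w"
  unfolding tmult_def lderiv_def by (simp add: sum.atMost_Suc_shift del: sum.atMost_Suc)

lemma lderiv_tmult: "lderiv i (tmult f g) = scl (f []) (lderiv i g) + tmult (lderiv i f) g"
  by (auto simp: fun_eq_iff lderiv_def[of i "tmult f g"] tmult_Cons lderiv_def[of i g])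

lemma tmult_linear:
  "tmult (f + f') g = tmult f g + tmult f' g"
  "tmult f (g + g') = tmult f g + tmult f g'"
  "tmult (scl c f) g = scl c (tmult f g)"
  by (auto simp: tmult_def fun_eq_iff algebra_simps sum.distrib sum_distrib_left)

lemma tmult_0_left [simp]: "tmult 0 g = 0"
  by (auto simp: tmult_def fun_eq_iff)

lemma tmult_assoc: "tmult (tmult f g) h = tmult f (tmult g h)"
proof
  fix w show "tmult (tmult f g) h w = tmult f (tmult g h) w"
    by (induction w arbitrary: f g h)
      (simp_all add: tmult_Cons lderiv_tmult tmult_linear algebra_simps)
qed

lemma tmult_one: "tmult (scalar_tensor 1) f = f" "tmult f (scalar_tensor 1) = f"
proof -
  show "tmult (scalar_tensor 1) f = f"
  proof
    fix w show "tmult (scalar_tensor 1) f w = f w"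
      by (cases w) (simp_all add: tmult_Cons, simp_all add: scalar_tensor_def)
  qed
  show "tmult f (scalar_tensor 1) = f"
  proof
    fix w show "tmult f (scalar_tensor 1) w = f w"
      by (induction w arbitrary: f) (simp_all add: tmult_Cons scalar_tensor_def lderiv_def)
  qed
qed

lemma tmult_scalar_left: "tmult (scalar_tensor z) f = scl z f"
proof -
  have "scalar_tensor z = scl z (scalar_tensor 1)" by (auto simp: scalar_tensor_def)
  then show ?thesis by (metis tmult_linear(3) tmult_one(1))
qed

lemma finite_support_tmult:
  assumes "finite {w. f w \<noteq> 0}" "finite {w. g w \<noteq> 0}"
  shows "finite {w. tmult f g w \<noteq> 0}"
proof (rule finite_subset)
  show "{w. tmult f g w \<noteq> 0} \<subseteq> (\<lambda>(u, v). u @ v) ` ({w. f w \<noteq> 0} \<times> {w. g w \<noteq> 0})"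
  proof
    fix w assume "w \<in> {w. tmult f g w \<noteq> 0}"
    then obtain k where "f (take k w) * g (drop k w) \<noteq> 0"
      unfolding tmult_def by (auto elim: sum.not_neutral_contains_not_neutral)
    then show "w \<in> (\<lambda>(u, v). u @ v) ` ({w. f w \<noteq> 0} \<times> {w. g w \<noteq> 0})"
      by (intro image_eqI[of _ _ "(take k w, drop k w)"]) auto
  qed
  show "finite ((\<lambda>(u, v). u @ v) ` ({w. f w \<noteq> 0} \<times> {w. g w \<noteq> 0}))"
    using assms by blast
qed

lemma finite_support_add:
  fixes f g :: "'i list \<Rightarrow> 'k::field"
  assumes "finite {w. f w \<noteq> 0}" "finite {w. g w \<noteq> 0}"
  shows "finite {w. f w + g w \<noteq> 0}"
  by (rule finite_subset[OF _ finite_UnI[OF assms]]) auto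

lemma ring_tensor_algebra: "ring (tensor_algebra :: ('i list \<Rightarrow> 'k::field) ring)"
proof (rule ringI)
  show "abelian_group (tensor_algebra :: ('i list \<Rightarrow> 'k) ring)"
  proof (rule abelian_groupI)
    fix x :: "'i list \<Rightarrow> 'k" assume "x \<in> carrier tensor_algebra"
    then have "- x \<in> carrier tensor_algebra" "- x \<oplus>\<^bsub>tensor_algebra\<^esub> x = \<zero>\<^bsub>tensor_algebra\<^esub>"
      by (auto simp: tensor_algebra_simps)
    then show "\<exists>y\<in>carrier tensor_algebra. y \<oplus>\<^bsub>tensor_algebra\<^esub> x = \<zero>\<^bsub>tensor_algebra\<^esub>" by blast
  qed (auto simp: tensor_algebra_simps algebra_simps finite_support_add)
  show "Group.monoid (tensor_algebra :: ('i list \<Rightarrow> 'k) ring)"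
    by (rule monoidI)
      (auto simp: tensor_algebra_simps tmult_assoc tmult_one finite_support_tmult,
        auto simp: scalar_tensor_def)
qed (auto simp: tensor_algebra_simps tmult_linear)

section \<open>Reduced words\<close>

text \<open>The first Lehmer digit \<open>l\<close> gives a block that carries the first tensor
  factor to position \<open>l\<close>; the other digits act on the remaining factors, hence the
  shift by \<open>Suc\<close>.\<close>

primrec lehmer_words :: "nat \<Rightarrow> nat list set" where
  "lehmer_words 0 = {[]}"
| "lehmer_words (Suc m) = (\<lambda>(l, ps). rev [0..<l] @ map Suc ps) ` ({..m} \<times> lehmer_words m)"

lemma finite_lehmer_words: "finite (lehmer_words m)"
  by (induction m) auto

text \<open>An upper bound suffices here: that different digits give different words is deduced
  later, by counting permutations.\<close>

lemma card_lehmer_words_le: "card (lehmer_words m) \<le> fact m"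
proof (induction m)
  case (Suc m)
  have "card (lehmer_words (Suc m)) \<le> card ({..m} \<times> lehmer_words m)"
    unfolding lehmer_words.simps by (intro card_image_le) (simp add: finite_lehmer_words)
  also have "\<dots> \<le> fact (Suc m)"
    using mult_le_mono2[OF Suc, of "Suc m"] by (simp add: card_cartesian_product)
  finally show ?case .
qed simp

lemma concat_blocks_in_lehmer_words:
  "\<forall>k<m. L k < m - k \<Longrightarrow> concat (map (\<lambda>k. rev [k..<k + L k]) [0..<m]) \<in> lehmer_words m"
proof (induction m arbitrary: L)
  case (Suc m)
  let ?ps = "concat (map (\<lambda>k. rev [k..<k + L (Suc k)]) [0..<m])"
  have "map f [0..<Suc m] = f 0 # map (\<lambda>k. f (Suc k)) [0..<m]" for f :: "nat \<Rightarrow> nat list"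
    by (simp add: map_upt_Suc del: upt_Suc)
  then have "concat (map (\<lambda>k. rev [k..<k + L k]) [0..<Suc m]) = rev [0..<L 0] @ map Suc ?ps"
    by (simp add: map_concat comp_def rev_map[symmetric] map_Suc_upt del: upt_Suc)
  moreover have "?ps \<in> lehmer_words m"
    using Suc.prems by (intro Suc.IH) auto
  moreover have "L 0 \<le> m" using Suc.prems by auto
  ultimately show ?case
    unfolding lehmer_words.simps by (intro image_eqI[of _ _ "(L 0, ?ps)"]) auto
qed simp

lemma reduced_word_in_lehmer_words: "reduced_word m \<sigma> \<in> lehmer_words m"
proof -
  have "lehmer m \<sigma> k < m - k" if "k < m" for k
  proof -
    have "lehmer m \<sigma> k \<le> card {k<..<m}"
      unfolding lehmer_def by (intro card_mono) auto
    then show ?thesis using that by simp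
  qed
  then show ?thesis
    unfolding reduced_word_def by (intro concat_blocks_in_lehmer_words) auto
qed

text \<open>\<open>word_perm\<close> is a left inverse, so the map is injective. Surjectivity is a
  count: \<open>fact m\<close> permutations inject into a set of at most \<open>fact m\<close>
  words.\<close>

lemma bij_betw_reduced_word: "bij_betw (reduced_word m) {\<sigma>. \<sigma> permutes {..<m}} (lehmer_words m)"
proof -
  have inj: "inj_on (reduced_word m) {\<sigma>. \<sigma> permutes {..<m}}"
    by (rule inj_on_inverseI[of _ word_perm]) (simp add: word_perm_reduced_word)
  have "reduced_word m ` {\<sigma>. \<sigma> permutes {..<m}} = lehmer_words m"
  proof (rule card_seteq)
    show "card (lehmer_words m) \<le> card (reduced_word m ` {\<sigma>. \<sigma> permutes {..<m}})"
      using card_lehmer_words_le[of m] by (simp add: card_image[OF inj] card_permutations)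
  qed (auto simp: finite_lehmer_words reduced_word_in_lehmer_words)
  then show ?thesis using inj by (simp add: bij_betw_def)
qed

lemma card_lehmer_words: "card (lehmer_words m) = fact m"
  using bij_betw_same_card[OF bij_betw_reduced_word[of m]] by (simp add: card_permutations)

text \<open>This factors the symmetrizer: degree \<open>m\<close> acts on all tensor factors but the
  first, then the first factor is carried to each position \<open>l\<close>. The parametrization is
  injective because domain and image both have \<open>fact (Suc m)\<close> elements.\<close>

lemma sum_lehmer_words_Suc:
  "(\<Sum>ps\<in>lehmer_words (Suc m). h ps) = (\<Sum>l\<le>m. \<Sum>ps\<in>lehmer_words m. h (rev [0..<l] @ map Suc ps))"
proof -
  have "inj_on (\<lambda>(l, ps). rev [0..<l] @ map Suc ps) ({..m} \<times> lehmer_words m)"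
    using card_lehmer_words[of "Suc m"]
    by (intro eq_card_imp_inj_on) (simp_all add: finite_lehmer_words card_cartesian_product card_lehmer_words)
  then show ?thesis
    by (simp add: sum.reindex sum.cartesian_product case_prod_unfold)
qed

lemma quantum_symmetrizer_lehmer_words:
  "quantum_symmetrizer C m f = (\<lambda>w. \<Sum>ps\<in>lehmer_words m. foldr (braid_at C) ps f w)"
  unfolding quantum_symmetrizer_def braid_lift_def
  using sum.reindex_bij_betw[OF bij_betw_reduced_word, of "\<lambda>ps. foldr (braid_at C) ps f _" m] by auto

lemma braid_at_sum: "braid_at C p (\<lambda>v. \<Sum>x\<in>A. f x v) w = (\<Sum>x\<in>A. braid_at C p (f x) w)"
  by (auto simp: braid_at_def sum_distrib_left case_prod_unfold intro: sum.swap)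

lemma foldr_braid_at_sum:
  "foldr (braid_at C) ps (\<lambda>v. \<Sum>x\<in>A. f x v) = (\<lambda>w. \<Sum>x\<in>A. foldr (braid_at C) ps (f x) w)"
  by (induction ps) (auto simp: braid_at_sum)

lemma foldr_braid_at_map_Suc:
  "foldr (braid_at C) (map Suc ps) f (i # w) = foldr (braid_at C) ps (lderiv i f) w"
proof -
  have "lderiv i (foldr (braid_at C) (map Suc ps) f) = foldr (braid_at C) ps (lderiv i f)"
    by (induction ps) (auto simp: braid_at_def lderiv_def fun_eq_iff)
  then show ?thesis by (auto simp: lderiv_def fun_eq_iff)
qed

lemma foldr_braid_at_cong_length:
  assumes "\<And>v. length v = length w \<Longrightarrow> f v = g v"
  shows "foldr (braid_at C) ps f w = foldr (braid_at C) ps g w"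
  using assms
proof (induction ps arbitrary: w)
  case (Cons p ps)
  have "foldr (braid_at C) ps f v = foldr (braid_at C) ps g v" if "length v = length w" for v
    using that Cons by auto
  then show ?case by (simp add: braid_at_def[of C p] Cons.prems)
qed simp

lemma foldr_braid_at_0: "foldr (braid_at C) ps (\<lambda>w. 0) = (\<lambda>w. 0)"
  by (induction ps) (auto simp: braid_at_def)

section \<open>Quantum shuffle algebras\<close>

text \<open>As a map, \<open>c (x_i \<otimes> x_j) = q j i x_j \<otimes> x_i\<close>: the indices of
  \<open>q\<close> follow the order of the output.\<close>

definition diagonal :: "('i \<Rightarrow> 'i \<Rightarrow> 'k::field) \<Rightarrow> ('i, 'k) braiding" where
  "diagonal q = (\<lambda>(i, j) (k, l). if i = l \<and> j = k then q k l else 0)"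

locale diagonal_braiding =
  fixes q :: "'i::finite \<Rightarrow> 'i \<Rightarrow> 'k::field"
begin

text \<open>The factor collected when the letter \<open>j\<close> passes a word, that is, the action
  of the group-like element attached to \<open>j\<close>. It is the twist in the skew Leibniz rule
  for \<open>lderiv j\<close>.\<close>

definition character :: "'i \<Rightarrow> ('i list \<Rightarrow> 'k) \<Rightarrow> 'i list \<Rightarrow> 'k" where
  "character j f = (\<lambda>w. (\<Prod>k\<leftarrow>w. q j k) * f w)"

lemma character_simps [simp]:
  "character j (f + g) = character j f + character j g"
  "character j (f - g) = character j f - character j g"
  "character j 0 = 0"
  "character j (scl c f) = scl c (character j f)"
  "character j (scalar_tensor z) = scalar_tensor z"
  "character j (letter i) = scl (q j i) (letter i)"
  by (auto simp: character_def scl_def scalar_tensor_def letter_def fun_eq_iff algebra_simps)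

lemma lderiv_character: "lderiv i (character j f) = scl (q j i) (character j (lderiv i f))"
  by (auto simp: character_def scl_def lderiv_def fun_eq_iff algebra_simps)

lemma character_commute: "character i (character j f) = character j (character i f)"
  by (auto simp: character_def algebra_simps)

text \<open>The first letter of a shuffle comes from \<open>f\<close>, or from \<open>g\<close> after passing all of \<open>f\<close>.\<close>

primrec shuffle :: "('i list \<Rightarrow> 'k) \<Rightarrow> ('i list \<Rightarrow> 'k) \<Rightarrow> 'i list \<Rightarrow> 'k" where
  "shuffle f g [] = f [] * g []"
| "shuffle f g (j # w) = shuffle (lderiv j f) g w + shuffle (character j f) (lderiv j g) w"

lemma lderiv_shuffle [simp]:
  "lderiv j (shuffle f g) = shuffle (lderiv j f) g + shuffle (character j f) (lderiv j g)"
  by (auto simp: lderiv_def[of j "shuffle f g"])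

lemma shuffle_add_left [simp]: "shuffle (f + f') g = shuffle f g + shuffle f' g"
proof
  show "shuffle (f + f') g w = (shuffle f g + shuffle f' g) w" for w
    by (induction w arbitrary: f f' g) (simp_all add: algebra_simps)
qed

lemma shuffle_add_right [simp]: "shuffle f (g + g') = shuffle f g + shuffle f g'"
proof
  show "shuffle f (g + g') w = (shuffle f g + shuffle f g') w" for w
    by (induction w arbitrary: f g g') (simp_all add: algebra_simps)
qed

lemma shuffle_scl_left [simp]: "shuffle (scl c f) g = scl c (shuffle f g)"
proof
  show "shuffle (scl c f) g w = scl c (shuffle f g) w" for w
    by (induction w arbitrary: f g) (simp_all add: algebra_simps)
qed

lemma shuffle_scl_right [simp]: "shuffle f (scl c g) = scl c (shuffle f g)"
proof
  show "shuffle f (scl c g) w = scl c (shuffle f g) w" for w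
    by (induction w arbitrary: f g) (simp_all add: algebra_simps)
qed

lemma shuffle_diff_left [simp]: "shuffle (f - f') g = shuffle f g - shuffle f' g"
  by (metis add_diff_cancel diff_add_cancel shuffle_add_left)

lemma shuffle_diff_right [simp]: "shuffle f (g - g') = shuffle f g - shuffle f g'"
  by (metis add_diff_cancel diff_add_cancel shuffle_add_right)

lemma shuffle_0 [simp]: "shuffle 0 g = 0" "shuffle f 0 = 0"
  by (metis diff_self shuffle_diff_left shuffle_diff_right)+

lemma shuffle_scalar_left [simp]: "shuffle (scalar_tensor z) g = scl z g"
proof
  show "shuffle (scalar_tensor z) g w = scl z g w" for w
    by (induction w arbitrary: g) (simp_all, simp_all add: lderiv_def scalar_tensor_def)
qed

lemma shuffle_scalar_right [simp]: "shuffle g (scalar_tensor z) = scl z g"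
proof
  show "shuffle g (scalar_tensor z) w = scl z g w" for w
    by (induction w arbitrary: g) (simp_all, simp_all add: lderiv_def scalar_tensor_def)
qed

lemma character_shuffle [simp]: "character j (shuffle f g) = shuffle (character j f) (character j g)"
proof
  show "character j (shuffle f g) w = shuffle (character j f) (character j g) w" for w
  proof (induction w arbitrary: f g)
    case Nil
    then show ?case by (simp add: character_def)
  next
    case (Cons i w)
    have "character j (shuffle f g) (i # w) =
        q j i * (character j (shuffle (lderiv i f) g) w + character j (shuffle (character i f) (lderiv i g)) w)"
      by (simp add: character_def algebra_simps)
    then show ?case
      by (simp add: Cons lderiv_character character_commute[of j i] algebra_simps)
  qed
qed

text \<open>Differentiating either side gives three terms, one for each factor that can supply the
  first letter. They match because \<open>character j\<close> is multiplicative.\<close>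

lemma shuffle_assoc: "shuffle (shuffle f g) h = shuffle f (shuffle g h)"
proof
  show "shuffle (shuffle f g) h w = shuffle f (shuffle g h) w" for w
    by (induction w arbitrary: f g h) (simp_all add: algebra_simps)
qed

section \<open>The homomorphism from the tensor algebra to the shuffle algebra\<close>

lemma shuffle_letter_cong:
  "(\<And>v. Suc (length v) = length w \<Longrightarrow> f v = g v) \<Longrightarrow> shuffle (letter i) f w = shuffle (letter i) g w"
proof (induction w arbitrary: f g)
  case (Cons j w)
  have "shuffle (letter i) (lderiv j f) w = shuffle (letter i) (lderiv j g) w"
    using Cons.prems by (intro Cons.IH) (simp add: lderiv_def)
  then show ?case using Cons.prems by simp
qed (simp add: letter_def)

text \<open>The part of degree \<open>m\<close>: each word of length \<open>m\<close> is replaced by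
  the shuffle product of its letters, weighted by \<open>f\<close>. Fixing the degree makes the
  recursion primitive and needs no finite support.\<close>

primrec letter_products :: "nat \<Rightarrow> ('i list \<Rightarrow> 'k) \<Rightarrow> 'i list \<Rightarrow> 'k" where
  "letter_products 0 f = scalar_tensor (f [])"
| "letter_products (Suc m) f = (\<lambda>w. \<Sum>i\<in>UNIV. shuffle (letter i) (letter_products m (lderiv i f)) w)"

text \<open>The linear map that sends a word \<open>i\<^sub>1 \<dots> i\<^sub>m\<close> to the shuffle product of its letters.\<close>

definition letter_product :: "('i list \<Rightarrow> 'k) \<Rightarrow> 'i list \<Rightarrow> 'k" where
  "letter_product f = (\<lambda>w. letter_products (length w) f w)"

text \<open>The scalar term vanishes at nonempty words and the sum vanishes at \<open>[]\<close>, so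
  both cases of the recursion fit into one equation without the degree index.\<close>

lemma letter_product_rec:
  "letter_product f w = scalar_tensor (f []) w + (\<Sum>i\<in>UNIV. shuffle (letter i) (letter_product (lderiv i f)) w)"
proof (cases w)
  case Nil
  then show ?thesis by (simp add: letter_product_def letter_def)
next
  case (Cons j v)
  have "shuffle (letter i) (letter_products (length v) (lderiv i f)) w =
      shuffle (letter i) (letter_product (lderiv i f)) w" for i
    using Cons by (intro shuffle_letter_cong) (simp add: letter_product_def)
  then show ?thesis using Cons by (simp add: letter_product_def scalar_tensor_def)
qed

lemma letter_product_cong_length:
  "(\<And>v. length v = length w \<Longrightarrow> f v = g v) \<Longrightarrow> letter_product f w = letter_product g w"
proof (induction "length w" arbitrary: w f g)
  case 0
  then show ?case by (simp add: letter_product_def)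
next
  case (Suc m)
  have "shuffle (letter i) (letter_product (lderiv i f)) w = shuffle (letter i) (letter_product (lderiv i g)) w" for i
  proof (rule shuffle_letter_cong)
    fix v :: "'i list" assume "Suc (length v) = length w"
    then show "letter_product (lderiv i f) v = letter_product (lderiv i g) v"
      using Suc.hyps(2) by (intro Suc.hyps(1)) (auto simp: lderiv_def intro: Suc.prems)
  qed
  moreover have "scalar_tensor (f []) w = scalar_tensor (g []) w"
    using Suc.hyps(2) by (auto simp: scalar_tensor_def)
  ultimately show ?case by (simp only: letter_product_rec[of _ w])
qed

lemma letter_product_0 [simp]: "letter_product 0 = 0"
proof
  show "letter_product 0 w = 0 w" for w
  proof (induction "length w" arbitrary: w)
    case (Suc m)
    have "shuffle (letter i) (letter_product 0) w = shuffle (letter i) 0 w" for i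
      using Suc by (intro shuffle_letter_cong) simp
    then show ?case by (simp add: letter_product_rec scalar_tensor_def)
  qed (simp add: letter_product_def scalar_tensor_def)
qed

lemma letter_product_add: "letter_product (f + g) = letter_product f + letter_product g"
proof
  show "letter_product (f + g) w = (letter_product f + letter_product g) w" for w
  proof (induction "length w" arbitrary: w f g)
    case (Suc m)
    have "shuffle (letter i) (letter_product (lderiv i (f + g))) w =
        shuffle (letter i) (letter_product (lderiv i f) + letter_product (lderiv i g)) w" for i
      using Suc by (intro shuffle_letter_cong) simp
    then show ?case
      by (simp add: letter_product_rec[of _ w] sum.distrib scalar_tensor_def)
  qed (simp add: letter_product_def scalar_tensor_def)
qed

lemma letter_product_scl: "letter_product (scl c f) = scl c (letter_product f)"
proof
  show "letter_product (scl c f) w = scl c (letter_product f) w" for w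
  proof (induction "length w" arbitrary: w f)
    case (Suc m)
    have "shuffle (letter i) (letter_product (lderiv i (scl c f))) w =
        shuffle (letter i) (scl c (letter_product (lderiv i f))) w" for i
      using Suc by (intro shuffle_letter_cong) simp
    then show ?case
      by (simp add: letter_product_rec[of _ w] sum_distrib_left scalar_tensor_def algebra_simps)
  qed (simp add: letter_product_def scalar_tensor_def)
qed

lemma letter_product_diff: "letter_product (f - g) = letter_product f - letter_product g"
  by (metis add_diff_cancel diff_add_cancel letter_product_add)

lemma shuffle_sum_left: "shuffle (\<lambda>v. \<Sum>i\<in>A. f i v) g w = (\<Sum>i\<in>A. shuffle (f i) g w)"
proof (induction A rule: infinite_finite_induct)
  case (insert i A)
  have "(\<lambda>v. \<Sum>i\<in>insert i A. f i v) = f i + (\<lambda>v. \<Sum>i\<in>A. f i v)" using insert by auto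
  then show ?case using insert by simp
qed (simp_all add: zero_fun_def[symmetric])

text \<open>Induction on the degree. By \<open>lderiv_tmult\<close>, the words whose first letter
  comes from \<open>g\<close> rebuild \<open>f [] * letter_product g\<close>; for those whose first
  letter comes from \<open>f\<close>, the induction hypothesis and \<open>shuffle_assoc\<close>
  apply.\<close>

lemma letter_product_tmult:
  "letter_product (tmult f g) = shuffle (letter_product f) (letter_product g)"
proof
  show "letter_product (tmult f g) w = shuffle (letter_product f) (letter_product g) w" for w
  proof (induction "length w" arbitrary: w f g rule: less_induct)
    case less
    let ?S = "letter_product"
    have *: "shuffle (letter i) (?S (lderiv i (tmult f g))) w =
        f [] * shuffle (letter i) (?S (lderiv i g)) w + shuffle (shuffle (letter i) (?S (lderiv i f))) (?S g) w" for i
    proof -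
      have "shuffle (letter i) (?S (tmult (lderiv i f) g)) w =
          shuffle (letter i) (shuffle (?S (lderiv i f)) (?S g)) w"
        using less by (intro shuffle_letter_cong) simp
      then show ?thesis
        by (simp add: lderiv_tmult letter_product_add letter_product_scl shuffle_assoc)
    qed
    have f: "?S f = scalar_tensor (f []) + (\<lambda>w. \<Sum>i\<in>UNIV. shuffle (letter i) (?S (lderiv i f)) w)"
      by (rule ext) (simp add: letter_product_rec[of f])
    have "?S (tmult f g) w = f [] * scalar_tensor (g []) w +
        (\<Sum>i\<in>UNIV. f [] * shuffle (letter i) (?S (lderiv i g)) w) +
        (\<Sum>i\<in>UNIV. shuffle (shuffle (letter i) (?S (lderiv i f))) (?S g) w)"
      by (subst letter_product_rec) (simp add: * sum.distrib, simp add: scalar_tensor_def)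
    also have "\<dots> = f [] * ?S g w + (\<Sum>i\<in>UNIV. shuffle (shuffle (letter i) (?S (lderiv i f))) (?S g) w)"
      by (simp add: letter_product_rec[of g] sum_distrib_left distrib_left)
    also have "\<dots> = shuffle (?S f) (?S g) w"
      by (subst f) (simp add: shuffle_sum_left)
    finally show ?case .
  qed
qed

lemma letter_product_letter [simp]: "letter_product (letter i) = letter i"
proof -
  have 1: "letter_product (scalar_tensor 1) = scalar_tensor 1"
    by (rule ext, subst letter_product_rec) (simp, simp add: scalar_tensor_def)
  show ?thesis
  proof
    fix w
    have "shuffle (letter j) (letter_product (lderiv j (letter i))) w = (if j = i then letter i w else 0)" for j
      by (simp add: 1)
    then show "letter_product (letter i) w = letter i w"
      by (subst letter_product_rec) (simp add: letter_def, simp add: scalar_tensor_def)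
  qed
qed

section \<open>The quantum symmetrizer of a diagonal braiding\<close>

lemma braid_at_diagonal:
  "braid_at (diagonal q) p f w = (if Suc p < length w
     then q (w ! p) (w ! Suc p) * f (w[p := w ! Suc p, Suc p := w ! p]) else f w)"
proof -
  have "(\<Sum>(i, j)\<in>UNIV. diagonal q (i, j) (k, l) * h i j) = q k l * h l k" for k l and h :: "'i \<Rightarrow> 'i \<Rightarrow> 'k"
  proof -
    have "(\<Sum>(i, j)\<in>UNIV. diagonal q (i, j) (k, l) * h i j) =
        (\<Sum>x\<in>UNIV. if x = (l, k) then q k l * h l k else 0)"
      by (intro sum.cong) (auto simp: diagonal_def split: if_splits)
    then show ?thesis by simp
  qed
  then show ?thesis by (simp add: braid_at_def)
qed

text \<open>The block \<open>rev [0..<l]\<close> carries the first factor past \<open>l\<close>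
  others, collecting one entry of \<open>q\<close> for each. Summed over \<open>l\<close>, this
  shuffles that letter into the rest.\<close>

lemma sum_insertions:
  "(\<Sum>l<length w. foldr (braid_at (diagonal q)) (rev [0..<l]) f w) = (\<Sum>i\<in>UNIV. shuffle (letter i) (lderiv i f) w)"
proof (induction w arbitrary: f)
  case (Cons j w)
  let ?c = "braid_at (diagonal q)"
  \<comment> \<open>Exchange the first two factors, then strip the letter \<open>j\<close> now in
    front: a block of length \<open>Suc l\<close> on \<open>f\<close> becomes one of length
    \<open>l\<close> on \<open>f'\<close>. The empty block gives the term in which the letter stays
    first.\<close>
  define f' where "f' = lderiv j (?c 0 f)"
  have f': "shuffle (letter i) (lderiv i f') w = q j i * shuffle (letter i) (lderiv j (lderiv i f)) w" for i
  proof -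
    have "lderiv i f' = scl (q j i) (lderiv j (lderiv i f))"
      by (auto simp: fun_eq_iff f'_def lderiv_def braid_at_diagonal)
    then show ?thesis by simp
  qed
  have "foldr ?c (rev [0..<Suc l]) f (j # w) = foldr ?c (rev [0..<l]) f' w" for l
  proof -
    have "[0..<Suc l] = 0 # map Suc [0..<l]"
      by (simp add: map_Suc_upt upt_conv_Cons del: upt_Suc)
    then have "rev [0..<Suc l] = map Suc (rev [0..<l]) @ [0]" by (simp add: rev_map)
    then show ?thesis by (simp add: foldr_braid_at_map_Suc f'_def del: upt_Suc)
  qed
  then have "(\<Sum>l<length (j # w). foldr ?c (rev [0..<l]) f (j # w)) =
      f (j # w) + (\<Sum>l<length w. foldr ?c (rev [0..<l]) f' w)"
    by (simp add: sum.lessThan_Suc_shift del: upt_Suc sum.lessThan_Suc)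
  also have "\<dots> = lderiv j f w + (\<Sum>i\<in>UNIV. q j i * shuffle (letter i) (lderiv j (lderiv i f)) w)"
    by (simp add: Cons f') (simp add: lderiv_def)
  also have "\<dots> = (\<Sum>i\<in>UNIV. (if i = j then lderiv i f w else 0) +
      q j i * shuffle (letter i) (lderiv j (lderiv i f)) w)"
    by (simp add: sum.distrib)
  also have "\<dots> = (\<Sum>i\<in>UNIV. shuffle (letter i) (lderiv i f) (j # w))"
    by (intro sum.cong) auto
  finally show ?case .
qed (simp add: letter_def)

text \<open>In the factorization of \<open>sum_lehmer_words_Suc\<close>, the inner sum
  \<open>g\<close> is the induction hypothesis applied behind the first letter, and the outer sum is
  \<open>sum_insertions\<close>. Together they are the recursion of
  \<open>letter_product\<close>.\<close>

lemma sum_lehmer_words_eq_letter_product: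
  "length w = m \<Longrightarrow> (\<Sum>ps\<in>lehmer_words m. foldr (braid_at (diagonal q)) ps f w) = letter_product f w"
proof (induction m arbitrary: w f)
  case 0
  then show ?case by (simp add: letter_product_def scalar_tensor_def)
next
  case (Suc m)
  let ?c = "braid_at (diagonal q)"
  define g where "g = (\<lambda>v. \<Sum>ps\<in>lehmer_words m. foldr ?c (map Suc ps) f v)"
  have "shuffle (letter i) (lderiv i g) w = shuffle (letter i) (letter_product (lderiv i f)) w" for i
  proof (rule shuffle_letter_cong)
    fix v :: "'i list" assume "Suc (length v) = length w"
    moreover have "lderiv i g v = g (i # v)" by (simp only: lderiv_def)
    moreover have "g (i # v) = (\<Sum>ps\<in>lehmer_words m. foldr ?c ps (lderiv i f) v)"
      by (simp only: g_def foldr_braid_at_map_Suc)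
    ultimately show "lderiv i g v = letter_product (lderiv i f) v"
      using Suc by simp
  qed
  moreover have "(\<Sum>ps\<in>lehmer_words (Suc m). foldr ?c ps f w) = (\<Sum>l<length w. foldr ?c (rev [0..<l]) g w)"
    by (simp add: Suc.prems sum_lehmer_words_Suc g_def foldr_braid_at_sum lessThan_Suc_atMost del: lehmer_words.simps)
  moreover have "scalar_tensor (f []) w = 0"
    using Suc.prems by (auto simp: scalar_tensor_def)
  ultimately show ?case by (simp add: sum_insertions letter_product_rec[of f w])
qed

lemma quantum_symmetrizer_diagonal:
  "quantum_symmetrizer (diagonal q) m (tensor_component m f) w = (if length w = m then letter_product f w else 0)"
proof (cases "length w = m")
  case True
  have "foldr (braid_at (diagonal q)) ps (tensor_component m f) w = foldr (braid_at (diagonal q)) ps f w" for ps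
    using True by (intro foldr_braid_at_cong_length) (simp add: tensor_component_def)
  then show ?thesis
    using True by (simp add: quantum_symmetrizer_lehmer_words sum_lehmer_words_eq_letter_product)
next
  case False
  have "foldr (braid_at (diagonal q)) ps (tensor_component m f) w = foldr (braid_at (diagonal q)) ps (\<lambda>v. 0) w" for ps
    using False by (intro foldr_braid_at_cong_length) (simp add: tensor_component_def)
  then show ?thesis
    using False by (simp add: quantum_symmetrizer_lehmer_words foldr_braid_at_0)
qed

end


section \<open>The affine Cartan type of rank two\<close>

definition affine_matrix :: "'k::field \<Rightarrow> idx \<Rightarrow> idx \<Rightarrow> 'k" where
  "affine_matrix b = (\<lambda>i j. if i = j then b else inverse b)"

definition homogeneous :: "nat \<Rightarrow> ('i list \<Rightarrow> 'k::field) \<Rightarrow> bool" where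
  "homogeneous m f \<longleftrightarrow> (\<forall>w. f w \<noteq> 0 \<longrightarrow> length w = m)"

lemma homogeneous_tmult:
  assumes "homogeneous m f" "homogeneous n g"
  shows "homogeneous (m + n) (tmult f g)"
  unfolding homogeneous_def
proof (intro allI impI)
  fix w assume "tmult f g w \<noteq> 0"
  then obtain k where "k \<in> {..length w}" "f (take k w) * g (drop k w) \<noteq> 0"
    unfolding tmult_def by (rule sum.not_neutral_contains_not_neutral)
  then have "f (take k w) \<noteq> 0" "g (drop k w) \<noteq> 0" "k \<le> length w" by auto
  then have "length (take k w) = m" "length (drop k w) = n"
    using assms unfolding homogeneous_def by blast+
  then show "length w = m + n" using \<open>k \<le> length w\<close> by simp
qed

lemma homogeneous_diff: "homogeneous m f \<Longrightarrow> homogeneous m g \<Longrightarrow> homogeneous m (f - g)"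
  unfolding homogeneous_def by force

lemma homogeneous_scl: "homogeneous m f \<Longrightarrow> homogeneous m (scl c f)"
  unfolding homogeneous_def by simp

lemma homogeneous_letter: "homogeneous (Suc 0) (letter i)"
  unfolding homogeneous_def letter_def by auto

locale affine_A1 =
  fixes b :: "'k::field"
  assumes b_nz: "b \<noteq> 0"
begin

sublocale diagonal_braiding "affine_matrix b" .

lemma affine_matrix_simps [simp]:
  "affine_matrix b V1 V1 = b" "affine_matrix b V2 V2 = b"
  "affine_matrix b V1 V2 = inverse b" "affine_matrix b V2 V1 = inverse b"
  by (simp_all add: affine_matrix_def)

abbreviation "X \<equiv> letter V1 :: idx list \<Rightarrow> 'k"
abbreviation "Y \<equiv> letter V2 :: idx list \<Rightarrow> 'k"
abbreviation "d \<equiv> 1 - inverse b * inverse b"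

section \<open>Root vectors and their skew derivatives\<close>

definition delta :: "idx list \<Rightarrow> 'k" where
  "delta = shuffle X Y - scl (inverse b) (shuffle Y X)"

lemma scl_1 [simp]: "scl 1 f = f"
  by (simp add: fun_eq_iff)

lemma scl_scl [simp]: "scl c (scl c' f) = scl (c * c') f"
  by (simp add: fun_eq_iff)

lemma scl_0 [simp]: "scl c 0 = 0"
  by (simp add: fun_eq_iff)

lemma scl_diff: "scl c (f - g) = scl c f - scl c g"
  by (simp add: fun_eq_iff algebra_simps)

text \<open>Both characters are \<open>b * inverse b = 1\<close> in the degree of \<open>X\<close>
  times \<open>Y\<close>. The coefficient in \<open>delta\<close> is the one for which the two
  contributions to the derivative by \<open>V2\<close> cancel.\<close>

lemma delta_simps [simp]:
  "delta [] = 0" "lderiv V1 delta = scl d Y" "lderiv V2 delta = 0"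
  "character V1 delta = delta" "character V2 delta = delta"
  using b_nz by (simp_all add: delta_def) (simp_all add: fun_eq_iff algebra_simps)

primrec real_root :: "nat \<Rightarrow> idx list \<Rightarrow> 'k" where
  "real_root 0 = X"
| "real_root (Suc n) = shuffle delta (real_root n) - shuffle (real_root n) delta"

definition imaginary_root :: "nat \<Rightarrow> idx list \<Rightarrow> 'k" where
  "imaginary_root n = lderiv V1 (real_root n)"

text \<open>The real root vector next to \<open>Y\<close>, the counterpart of
  \<open>real_root 1\<close>. It is the correction that arises when an imaginary root vector moves
  past \<open>Y\<close>.\<close>

definition opposite_root :: "idx list \<Rightarrow> 'k" where
  "opposite_root = shuffle delta Y - shuffle Y delta"

text \<open>The degree differs from that of \<open>X\<close> by a multiple of the degree of
  \<open>delta\<close>, so characters act as on \<open>X\<close>. The derivative by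
  \<open>V2\<close> kills \<open>X\<close> and \<open>delta\<close>, hence everything they
  generate.\<close>

lemma real_root_simps [simp]:
  "real_root n [] = 0" "lderiv V2 (real_root n) = 0"
  "character V1 (real_root n) = scl b (real_root n)"
  "character V2 (real_root n) = scl (inverse b) (real_root n)"
proof -
  show "character V1 (real_root n) = scl b (real_root n)"
  proof (induction n)
    case (Suc n)
    have "character V1 (real_root n) = scl b (real_root n)" by (rule Suc)
    then show "character V1 (real_root (Suc n)) = scl b (real_root (Suc n))" by (simp add: scl_diff)
  qed simp
  show "character V2 (real_root n) = scl (inverse b) (real_root n)"
  proof (induction n)
    case (Suc n)
    have "character V2 (real_root n) = scl (inverse b) (real_root n)" by (rule Suc)
    then show "character V2 (real_root (Suc n)) = scl (inverse b) (real_root (Suc n))" by (simp add: scl_diff)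
  qed simp
  show "real_root n [] = 0" by (induction n) auto
  show "lderiv V2 (real_root n) = 0"
  proof (induction n)
    case (Suc n)
    have "lderiv V2 (real_root n) = 0" by (rule Suc)
    then show "lderiv V2 (real_root (Suc n)) = 0" by simp
  qed simp
qed

lemma lderiv_real_root [simp]: "lderiv V1 (real_root n) = imaginary_root n"
  by (simp add: imaginary_root_def)

lemma imaginary_root_0 [simp]: "imaginary_root 0 = scalar_tensor 1"
  by (simp add: imaginary_root_def)

lemma imaginary_root_Suc:
  "imaginary_root (Suc n) = shuffle delta (imaginary_root n) - shuffle (imaginary_root n) delta
    + scl d (shuffle Y (real_root n) - scl b (shuffle (real_root n) Y))"
  by (simp add: imaginary_root_def[of "Suc n"]) (auto simp: fun_eq_iff algebra_simps)

lemma imaginary_root_simps [simp]: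
  "lderiv V2 (imaginary_root n) = 0"
  "character V1 (imaginary_root n) = imaginary_root n"
  "character V2 (imaginary_root n) = imaginary_root n"
proof -
  show "lderiv V2 (imaginary_root n) = 0"
  proof (induction n)
    case (Suc n)
    have "lderiv V2 (imaginary_root n) = 0" by (rule Suc)
    then show "lderiv V2 (imaginary_root (Suc n)) = 0"
      using b_nz by (simp add: imaginary_root_Suc)
  qed simp
  \<comment> \<open>Differentiating the eigenvalue equation of \<open>real_root n\<close> yields the
    character of its derivative; the factor from \<open>lderiv_character\<close> cancels the
    eigenvalue.\<close>
  have "lderiv V1 (character j (real_root n)) = scl (affine_matrix b j V1) (character j (imaginary_root n))" for j
    by (simp add: lderiv_character)
  from this[of V1] this[of V2]
  show "character V1 (imaginary_root n) = imaginary_root n"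
    "character V2 (imaginary_root n) = imaginary_root n"
    using b_nz by (auto simp: fun_eq_iff)
qed

lemma opposite_root_simps [simp]:
  "opposite_root [] = 0" "lderiv V2 opposite_root = 0"
  "lderiv V1 opposite_root = scl (d * (1 - inverse b)) (shuffle Y Y)"
  "character V1 opposite_root = scl (inverse b) opposite_root"
  "character V2 opposite_root = scl b opposite_root"
  by (simp_all add: opposite_root_def) (simp_all add: fun_eq_iff algebra_simps)

section \<open>Commutation of imaginary root vectors with \<open>delta\<close>\<close>

lemma eq_by_lderiv_idx:
  fixes f g :: "idx list \<Rightarrow> 'k"
  assumes "f [] = g []" "lderiv V1 f = lderiv V1 g" "lderiv V2 f = lderiv V2 g"
  shows "f = g"
proof (rule eq_by_lderiv)
  show "lderiv i f = lderiv i g" for i using assms by (cases i) simp_all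
qed (rule assms)

text \<open>The quantum Serre relation of degree one in \<open>X\<close> and three in
  \<open>Y\<close>. It holds in the shuffle algebra because both sides have the same skew
  derivatives.\<close>

lemma Y_opposite_root: "shuffle Y opposite_root = scl (inverse b) (shuffle opposite_root Y)"
proof (rule eq_by_lderiv_idx)
  show "lderiv V1 (shuffle Y opposite_root) = lderiv V1 (scl (inverse b) (shuffle opposite_root Y))"
    by (simp add: shuffle_assoc mult_ac)
  show "lderiv V2 (shuffle Y opposite_root) = lderiv V2 (scl (inverse b) (shuffle opposite_root Y))"
    using b_nz by (simp add: shuffle_assoc)
qed simp

lemma lderiv_imaginary_root_Suc:
  assumes "shuffle delta (imaginary_root n) = shuffle (imaginary_root n) delta"
  shows "lderiv V1 (imaginary_root (Suc n)) =
    scl d (scl (inverse b) (shuffle Y (imaginary_root n)) - scl b (shuffle (imaginary_root n) Y))"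
  using assms by (simp add: imaginary_root_Suc)

text \<open>Both sides have zero derivative by \<open>V2\<close>. Equality of the derivatives by
  \<open>V1\<close> amounts to the second assumption times \<open>d\<close>: as \<open>delta\<close>
  commutes with \<open>imaginary_root n\<close>, its commutator with the derivative only replaces
  \<open>Y\<close> by \<open>opposite_root\<close>.\<close>

lemma commutator_step:
  assumes "shuffle delta (imaginary_root n) = shuffle (imaginary_root n) delta"
    and "shuffle (imaginary_root (Suc n)) Y = shuffle Y (imaginary_root (Suc n)) +
      scl (inverse b) (shuffle opposite_root (imaginary_root n)) - scl b (shuffle (imaginary_root n) opposite_root)"
  shows "shuffle delta (imaginary_root (Suc n)) = shuffle (imaginary_root (Suc n)) delta"
proof (rule eq_by_lderiv_idx)
  let ?A = "imaginary_root n"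
  have A: "shuffle ?A delta = shuffle delta ?A" "shuffle ?A (shuffle delta h) = shuffle delta (shuffle ?A h)" for h
    by (simp_all add: assms(1) shuffle_assoc[symmetric])
  show "lderiv V1 (shuffle delta (imaginary_root (Suc n))) = lderiv V1 (shuffle (imaginary_root (Suc n)) delta)"
    by (simp add: lderiv_imaginary_root_Suc[OF assms(1)] assms(2))
      (simp add: opposite_root_def shuffle_assoc A fun_eq_iff algebra_simps)
qed simp_all

text \<open>\<open>A'\<close> plays the role of the preceding imaginary root vector. Leaving it free
  allows \<open>A' = 0\<close> at the start of the induction, where there is no predecessor.\<close>

lemma Y_commutator_step:
  assumes c: "shuffle delta (imaginary_root n) = shuffle (imaginary_root n) delta"
    and Q: "lderiv V1 (imaginary_root n) = scl d (scl (inverse b) (shuffle Y A') - scl b (shuffle A' Y))"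
    and v: "shuffle (imaginary_root n) Y = shuffle Y (imaginary_root n) +
      scl (inverse b) (shuffle opposite_root A') - scl b (shuffle A' opposite_root)"
  shows "shuffle (imaginary_root (Suc n)) Y = shuffle Y (imaginary_root (Suc n)) +
      scl (inverse b) (shuffle opposite_root (imaginary_root n)) - scl b (shuffle (imaginary_root n) opposite_root)"
    (is "?l = ?r")
proof (rule eq_by_lderiv_idx)
  let ?A = "imaginary_root n"
  \<comment> \<open>These rules also act inside right-nested products: \<open>Y\<close> moves past
    \<open>opposite_root\<close> by the Serre relation, and \<open>?A\<close> past \<open>Y\<close>
    by the assumption. The derivatives by \<open>V1\<close> then agree term by term.\<close>
  have Y: "shuffle Y (shuffle opposite_root h) = scl (inverse b) (shuffle opposite_root (shuffle Y h))" for h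
    by (simp add: Y_opposite_root shuffle_assoc[symmetric])
  have v': "shuffle ?A (shuffle Y h) = shuffle (shuffle Y ?A +
      scl (inverse b) (shuffle opposite_root A') - scl b (shuffle A' opposite_root)) h" for h
    by (simp only: v shuffle_assoc[symmetric])
  show "lderiv V1 ?l = lderiv V1 ?r"
    using b_nz
    by (simp add: lderiv_imaginary_root_Suc[OF c] Q)
      (simp add: shuffle_assoc v v' Y Y_opposite_root fun_eq_iff field_simps)
  show "lderiv V2 ?l = lderiv V2 ?r" by simp
qed simp

lemma delta_commutes: "shuffle delta (imaginary_root n) = shuffle (imaginary_root n) delta"
proof -
  \<comment> \<open>The two commutation rules need each other, so they are proved together with the
    derivative formula. The witness \<open>A'\<close> is \<open>0\<close> for \<open>n = 0\<close>
    and the preceding imaginary root vector afterwards.\<close>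
  have "shuffle delta (imaginary_root n) = shuffle (imaginary_root n) delta \<and>
    (\<exists>A'. lderiv V1 (imaginary_root n) = scl d (scl (inverse b) (shuffle Y A') - scl b (shuffle A' Y)) \<and>
      shuffle (imaginary_root n) Y = shuffle Y (imaginary_root n) +
      scl (inverse b) (shuffle opposite_root A') - scl b (shuffle A' opposite_root))"
  proof (induction n)
    case 0
    have "lderiv V1 (imaginary_root 0) = scl d (scl (inverse b) (shuffle Y 0) - scl b (shuffle 0 Y))"
      "shuffle (imaginary_root 0) Y = shuffle Y (imaginary_root 0) +
        scl (inverse b) (shuffle opposite_root 0) - scl b (shuffle 0 opposite_root)"
      "shuffle delta (imaginary_root 0) = shuffle (imaginary_root 0) delta"
      by simp_all
    then show ?case by blast
  next
    case (Suc n)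
    then have v: "shuffle (imaginary_root (Suc n)) Y = shuffle Y (imaginary_root (Suc n)) +
      scl (inverse b) (shuffle opposite_root (imaginary_root n)) - scl b (shuffle (imaginary_root n) opposite_root)"
      using Y_commutator_step by blast
    show ?case
      using commutator_step[OF conjunct1[OF Suc] v] lderiv_imaginary_root_Suc[OF conjunct1[OF Suc]] v by blast
  qed
  then show ?thesis by blast
qed

section \<open>Nonvanishing of the real root vectors and their lifts to tensors\<close>

lemma imaginary_root_alternating_word:
  "imaginary_root n (concat (replicate n [V1, V2])) = (d * (inverse b - b)) ^ n"
proof (induction n)
  case (Suc n)
  \<comment> \<open>Differentiate by \<open>V1\<close>, then by \<open>V2\<close>. The second
    derivative acts only on the letter \<open>Y\<close>, since it kills
    \<open>imaginary_root n\<close>, whose character is trivial; the two orders of the product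
    contribute \<open>inverse b\<close> and \<open>- b\<close>.\<close>
  have "imaginary_root (Suc n) (V1 # V2 # w) = d * (inverse b - b) * imaginary_root n w" for w
  proof -
    have "imaginary_root (Suc n) (V1 # V2 # w) = lderiv V2 (lderiv V1 (imaginary_root (Suc n))) w"
      by (simp only: lderiv_def)
    then show ?thesis
      by (simp add: lderiv_imaginary_root_Suc[OF delta_commutes]) (simp add: algebra_simps)
  qed
  then show ?case by (simp add: Suc)
qed (simp add: scalar_tensor_def)

lemma real_root_nonzero:
  assumes "b ^ 2 \<noteq> 1"
  shows "real_root n (V1 # concat (replicate n [V1, V2])) \<noteq> 0"
proof -
  have "d \<noteq> 0" "inverse b - b \<noteq> 0"
    using assms b_nz by (auto simp: field_simps power2_eq_square)
  moreover have "real_root n (V1 # w) = imaginary_root n w" for w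
    by (simp only: imaginary_root_def lderiv_def)
  ultimately show ?thesis by (simp add: imaginary_root_alternating_word)
qed

text \<open>The recursion of \<open>real_root\<close> is repeated with \<open>tmult\<close> in place
  of \<open>shuffle\<close>, and \<open>letter_product\<close> maps one construction to the
  other.\<close>

lemma real_root_tensor:
  "\<exists>t. homogeneous (2 * n + 1) t \<and> letter_product t = real_root n"
proof (induction n)
  case 0
  show ?case by (rule exI[of _ X]) (simp add: homogeneous_letter)
next
  case (Suc n)
  then obtain t where t: "homogeneous (2 * n + 1) t" "letter_product t = real_root n" by blast
  define D where "D = tmult X Y - scl (inverse b) (tmult Y X)"
  have D: "homogeneous 2 D" "letter_product D = delta"
    using homogeneous_tmult[OF homogeneous_letter homogeneous_letter]
    by (auto simp: D_def delta_def letter_product_diff letter_product_scl letter_product_tmult numeral_2_eq_2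
        intro!: homogeneous_diff homogeneous_scl)
  have "homogeneous (2 * Suc n + 1) (tmult D t - tmult t D)"
    using homogeneous_tmult[OF D(1) t(1)] homogeneous_tmult[OF t(1) D(1)]
    by (auto intro!: homogeneous_diff simp: add.commute)
  moreover have "letter_product (tmult D t - tmult t D) = real_root (Suc n)"
    using D t by (simp add: letter_product_diff letter_product_tmult)
  ultimately show ?case by blast
qed

end

section \<open>Removing the twist by the flip\<close>

primrec flip :: "idx \<Rightarrow> idx" where
  "flip V1 = V2"
| "flip V2 = V1"

lemma flip_flip [simp]: "flip (flip i) = i"
  by (cases i) simp_all

lemma flip_comp_flip [simp]: "flip \<circ> flip = id"
  by auto

text \<open>Flipping the second of two adjacent factors turns the braiding of \<open>V_abe\<close>
  into an exchange of letters: \<open>v_1 v_1\<close> becomes \<open>x_1 x_2\<close>, and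
  \<open>v_2 v_2\<close> becomes \<open>x_2 x_1\<close>. Flipping the whole tail at each letter does
  this for all adjacent pairs at once.\<close>

primrec alternate :: "idx list \<Rightarrow> idx list" where
  "alternate [] = []"
| "alternate (i # w) = i # map flip (alternate w)"

lemma length_alternate [simp]: "length (alternate w) = length w"
  by (induction w) simp_all

lemma alternate_map_flip: "alternate (map flip w) = map flip (alternate w)"
  by (induction w) simp_all

lemma alternate_alternate [simp]: "alternate (alternate w) = w"
  by (induction w) (simp_all add: alternate_map_flip)

lemma alternate_append:
  "alternate (u @ v) = alternate u @ (if even (length u) then alternate v else map flip (alternate v))"
  by (induction u) simp_all

lemma take_drop_alternate:
  assumes "k \<le> length w"
  shows "take k (alternate w) = alternate (take k w)"
    "drop k (alternate w) = (if even k then alternate (drop k w) else map flip (alternate (drop k w)))"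
proof -
  have "alternate w = alternate (take k w) @
      (if even k then alternate (drop k w) else map flip (alternate (drop k w)))"
    using alternate_append[of "take k w" "drop k w"] assms by simp
  then show "take k (alternate w) = alternate (take k w)"
    "drop k (alternate w) = (if even k then alternate (drop k w) else map flip (alternate (drop k w)))"
    using assms by simp_all
qed

context diagonal_braiding
begin

lemma letter_product_supported_0:
  assumes "\<And>v. length v = length w \<Longrightarrow> f v = 0"
  shows "letter_product f w = 0"
  using letter_product_cong_length[of w f 0] assms by simp

end

context affine_A1
begin

text \<open>\<open>affine_matrix b\<close> is invariant under \<open>flip\<close>, so renaming the
  letters is an automorphism of the shuffle algebra.\<close>

lemma shuffle_map_flip:
  "shuffle (\<lambda>v. f (map flip v)) (\<lambda>v. g (map flip v)) w = shuffle f g (map flip w)"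
proof (induction w arbitrary: f g)
  case (Cons j w)
  have d: "lderiv j (\<lambda>v. h (map flip v)) = (\<lambda>v. lderiv (flip j) h (map flip v))" for h :: "idx list \<Rightarrow> 'k"
    by (simp add: lderiv_def)
  have c: "character j (\<lambda>v. h (map flip v)) = (\<lambda>v. character (flip j) h (map flip v))" for h :: "idx list \<Rightarrow> 'k"
  proof -
    have "affine_matrix b j k = affine_matrix b (flip j) (flip k)" for k
      by (cases j; cases k) simp_all
    then show ?thesis by (simp add: character_def comp_def)
  qed
  show ?case by (simp add: c d Cons)
qed simp

lemma letter_product_map_flip: "letter_product (\<lambda>v. f (map flip v)) w = letter_product f (map flip w)"
proof (induction "length w" arbitrary: w f)
  case 0
  then show ?case by (simp add: letter_product_def scalar_tensor_def)
next
  case (Suc m)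
  have "shuffle (letter i) (letter_product (lderiv i (\<lambda>v. f (map flip v)))) w =
      shuffle (letter (flip i)) (letter_product (lderiv (flip i) f)) (map flip w)" for i
  proof -
    have "letter i = (\<lambda>v. letter (flip i) (map flip v) :: 'k)"
      by (auto simp: letter_def fun_eq_iff map_eq_Cons_conv) (metis flip_flip)
    moreover have "shuffle (letter i) (letter_product (lderiv i (\<lambda>v. f (map flip v)))) w =
      shuffle (letter i) (\<lambda>v. letter_product (lderiv (flip i) f) (map flip v)) w"
    proof (rule shuffle_letter_cong)
      fix v :: "idx list" assume "Suc (length v) = length w"
      then have "m = length v" using Suc.hyps(2) by simp
      moreover have "lderiv i (\<lambda>v. f (map flip v)) = (\<lambda>v. lderiv (flip i) f (map flip v))"
        by (simp add: lderiv_def)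
      ultimately show "letter_product (lderiv i (\<lambda>v. f (map flip v))) v = letter_product (lderiv (flip i) f) (map flip v)"
        using Suc.hyps(1) by simp
    qed
    ultimately show ?thesis by (simp only: shuffle_map_flip)
  qed
  then show ?case
    by (simp add: letter_product_rec[of _ w] letter_product_rec[of _ "map flip w"] UNIV_idx scalar_tensor_def)
qed

end

text \<open>The factor \<open>\<mu>\<^sup>r\<close>, with \<open>r\<close> the number of letters \<open>V2\<close>, rescales the second basis vector so that
  \<open>a\<close> and \<open>e\<close> become equal.\<close>

definition twist :: "'k::field \<Rightarrow> (idx list \<Rightarrow> 'k) \<Rightarrow> idx list \<Rightarrow> 'k" where
  "twist \<mu> f = (\<lambda>w. \<mu> ^ count_list w V2 * f (alternate w))"

lemma twist_surj:
  assumes "\<mu> \<noteq> 0"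
  obtains g where "f = twist \<mu> g"
proof
  show "f = twist \<mu> (\<lambda>w. f (alternate w) / \<mu> ^ count_list (alternate w) V2)"
    using assms by (auto simp: twist_def fun_eq_iff)
qed

lemma twist_eq_0_iff: "\<mu> \<noteq> 0 \<Longrightarrow> twist \<mu> f = (\<lambda>w. 0) \<longleftrightarrow> f = 0"
  unfolding twist_def fun_eq_iff by (simp add: zero_fun_def) (metis alternate_alternate)

lemma twist_add: "twist \<mu> (f + g) = twist \<mu> f + twist \<mu> g"
  by (simp add: twist_def fun_eq_iff algebra_simps)

lemma twist_diff: "twist \<mu> (f - g) = twist \<mu> f - twist \<mu> g"
  by (simp add: twist_def fun_eq_iff algebra_simps)

definition even_part :: "('i list \<Rightarrow> 'k::field) \<Rightarrow> 'i list \<Rightarrow> 'k" where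
  "even_part f = (\<lambda>w. if even (length w) then f w else 0)"

definition odd_part :: "('i list \<Rightarrow> 'k::field) \<Rightarrow> 'i list \<Rightarrow> 'k" where
  "odd_part f = (\<lambda>w. if odd (length w) then f w else 0)"

text \<open>\<open>twist\<close> is not multiplicative: a left factor of odd length changes the
  parity of all positions in the right factor, which therefore appears flipped.\<close>

lemma tmult_twist:
  "tmult (twist \<mu> f) (twist \<mu> g) =
    twist \<mu> (tmult (even_part f) g + tmult (odd_part f) (\<lambda>w. g (map flip w)))"
proof
  fix w
  have "twist \<mu> f (take k w) * twist \<mu> g (drop k w) = \<mu> ^ count_list w V2 *
      (even_part f (take k (alternate w)) * g (drop k (alternate w)) +
        odd_part f (take k (alternate w)) * g (map flip (drop k (alternate w))))" if "k \<le> length w" for k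
  proof -
    have "count_list w V2 = count_list (take k w) V2 + count_list (drop k w) V2"
      by (metis append_take_drop_id count_list_append)
    then show ?thesis
      using that by (auto simp: twist_def even_part_def odd_part_def take_drop_alternate power_add)
  qed
  then have "tmult (twist \<mu> f) (twist \<mu> g) w = (\<Sum>k\<le>length w. \<mu> ^ count_list w V2 *
      (even_part f (take k (alternate w)) * g (drop k (alternate w)) +
        odd_part f (take k (alternate w)) * g (map flip (drop k (alternate w)))))"
    unfolding tmult_def by (intro sum.cong) auto
  also have "\<dots> = \<mu> ^ count_list w V2 *
      (tmult (even_part f) g (alternate w) + tmult (odd_part f) (\<lambda>w. g (map flip w)) (alternate w))"
    by (simp add: tmult_def sum.distrib sum_distrib_left distrib_left drop_map)
  finally show "tmult (twist \<mu> f) (twist \<mu> g) w =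
      twist \<mu> (tmult (even_part f) g + tmult (odd_part f) (\<lambda>w. g (map flip w))) w"
    by (simp add: twist_def)
qed

text \<open>Comparing coefficients of the two braidings requires \<open>a = \<mu> ^ 2 / b\<close>
  and \<open>e = 1 / (b * \<mu> ^ 2)\<close>. The first determines \<open>\<mu>\<close> up to sign;
  the second then says \<open>a * e * b ^ 2 = 1\<close>.\<close>

locale V_abe_affine = affine_A1 +
  fixes a e \<mu> :: "'a"
  assumes mu_sq: "\<mu> ^ 2 = a * b" and mu_nz: "\<mu> \<noteq> 0" and abe: "a * e * b ^ 2 = 1"
begin

abbreviation "C \<equiv> V_abe a b e"

text \<open>A check on the two letters at \<open>p\<close> and \<open>Suc p\<close>. The parity of
  \<open>p\<close> decides which of them is flipped, and the diagonal braiding is invariant under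
  \<open>flip\<close>, so both parities work.\<close>

lemma braid_at_twist: "braid_at C p (twist \<mu> f) = twist \<mu> (braid_at (diagonal (affine_matrix b)) p f)"
proof
  fix w
  show "braid_at C p (twist \<mu> f) w = twist \<mu> (braid_at (diagonal (affine_matrix b)) p f) w"
  proof (cases "Suc p < length w")
    case False
    then show ?thesis by (simp add: braid_at_def twist_def)
  next
    case True
    define u v where "u = take p w" and "v = drop (Suc (Suc p)) w"
    define x y where "x = w ! p" and "y = w ! Suc p"
    have w: "w = u @ x # y # v"
      using True by (simp add: u_def v_def x_def y_def Cons_nth_drop_Suc)
    have p: "p = length u" using True by (simp add: u_def)
    have U: "(UNIV :: (idx \<times> idx) set) = {(V1, V1), (V1, V2), (V2, V1), (V2, V2)}"
      unfolding UNIV_Times_UNIV[symmetric] UNIV_idx by auto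
    have a: "a = \<mu> ^ 2 / b" using mu_sq b_nz by simp
    have e: "e = 1 / (b * \<mu> ^ 2)" using abe b_nz mu_nz by (simp add: a field_simps power2_eq_square)
    have "braid_at C (length u) (twist \<mu> f) (u @ x # y # v) =
        twist \<mu> (braid_at (diagonal (affine_matrix b)) (length u) f) (u @ x # y # v)"
      using b_nz mu_nz by (cases x; cases y; cases "even (length u)";
        simp add: braid_at_def[of C] U braid_at_diagonal twist_def alternate_append nth_append
          list_update_append; simp add: a e power2_eq_square power_add field_simps)
    then show ?thesis by (simp add: w p)
  qed
qed

section \<open>The Nichols ideal as the twist of the kernel of \<open>letter_product\<close>\<close>

lemma quantum_symmetrizer_twist:
  "quantum_symmetrizer C m (twist \<mu> f) = twist \<mu> (quantum_symmetrizer (diagonal (affine_matrix b)) m f)"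
proof -
  have "foldr (braid_at C) ps (twist \<mu> f) = twist \<mu> (foldr (braid_at (diagonal (affine_matrix b))) ps f)" for ps
    by (induction ps) (simp_all add: braid_at_twist)
  then show ?thesis
    by (simp add: quantum_symmetrizer_lehmer_words) (simp add: twist_def sum_distrib_left)
qed

lemma twist_in_nichols_ideal_iff:
  "twist \<mu> f \<in> nichols_ideal C \<longleftrightarrow> twist \<mu> f \<in> carrier tensor_algebra \<and> letter_product f = 0"
proof -
  have "tensor_component m (twist \<mu> f) = twist \<mu> (tensor_component m f)" for m
    by (auto simp: tensor_component_def twist_def fun_eq_iff)
  then have "(\<forall>m. quantum_symmetrizer C m (tensor_component m (twist \<mu> f)) = (\<lambda>w. 0)) \<longleftrightarrow>
      (\<forall>m. quantum_symmetrizer (diagonal (affine_matrix b)) m (tensor_component m f) = 0)"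
    by (simp add: quantum_symmetrizer_twist twist_eq_0_iff mu_nz)
  also have "\<dots> \<longleftrightarrow> letter_product f = 0"
    by (auto simp: fun_eq_iff quantum_symmetrizer_diagonal)
  finally show ?thesis by (simp add: nichols_ideal_def)
qed

text \<open>The kernel of \<open>letter_product\<close> is graded and stable under
  \<open>flip\<close>, so the parity splitting in \<open>tmult_twist\<close> does no harm.\<close>

lemma tmult_twist_in_nichols_ideal:
  assumes "letter_product f = 0 \<or> letter_product g = 0"
    and "tmult (twist \<mu> f) (twist \<mu> g) \<in> carrier tensor_algebra"
  shows "tmult (twist \<mu> f) (twist \<mu> g) \<in> nichols_ideal C"
proof -
  have "letter_product (even_part f) = 0" "letter_product (odd_part f) = 0" if "letter_product f = 0"
  proof -
    have "letter_product (even_part f) w = (if even (length w) then letter_product f w else 0)" for w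
      by (auto simp: even_part_def intro!: letter_product_supported_0 letter_product_cong_length)
    then show "letter_product (even_part f) = 0" using that by (simp add: fun_eq_iff)
    have "letter_product (odd_part f) w = (if odd (length w) then letter_product f w else 0)" for w
      by (auto simp: odd_part_def intro!: letter_product_supported_0 letter_product_cong_length)
    then show "letter_product (odd_part f) = 0" using that by (simp add: fun_eq_iff)
  qed
  moreover have "letter_product (\<lambda>w. g (map flip w)) = 0" if "letter_product g = 0"
    using that by (simp add: fun_eq_iff letter_product_map_flip)
  ultimately have "letter_product (tmult (even_part f) g + tmult (odd_part f) (\<lambda>w. g (map flip w))) = 0"
    using assms(1) by (auto simp: letter_product_add letter_product_tmult)
  then show ?thesis
    using assms(2) by (simp only: tmult_twist twist_in_nichols_ideal_iff)
qed

lemma ideal_nichols_ideal: "ideal (nichols_ideal C) tensor_algebra"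
proof (rule idealI[OF ring_tensor_algebra])
  let ?T = "tensor_algebra :: (idx list \<Rightarrow> 'a) ring"
  interpret T: ring ?T by (rule ring_tensor_algebra)
  have sub: "nichols_ideal C \<subseteq> carrier ?T" by (auto simp: nichols_ideal_def)
  show "subgroup (nichols_ideal C) (add_monoid ?T)"
  proof (rule T.add.subgroupI)
    have "twist \<mu> 0 \<in> nichols_ideal C"
      by (simp add: twist_in_nichols_ideal_iff tensor_algebra_simps) (simp add: twist_def)
    then show "nichols_ideal C \<noteq> {}" by blast
    fix x assume x: "x \<in> nichols_ideal C"
    obtain f where f: "x = twist \<mu> f" by (rule twist_surj[OF mu_nz])
    have "- x = twist \<mu> (0 - f)" by (simp add: f twist_def fun_eq_iff)
    moreover have "letter_product (0 - f) = 0"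
      using x by (simp add: f twist_in_nichols_ideal_iff letter_product_diff del: diff_0)
    moreover have "- x \<in> carrier ?T" using x sub by (auto simp: tensor_algebra_simps)
    ultimately have "- x \<in> nichols_ideal C" by (simp only: twist_in_nichols_ideal_iff)
    moreover have "\<ominus>\<^bsub>?T\<^esub> x = - x"
      using x sub \<open>- x \<in> carrier ?T\<close> by (intro T.minus_equality) (auto simp: tensor_algebra_simps)
    ultimately show "\<ominus>\<^bsub>?T\<^esub> x \<in> nichols_ideal C" by simp
  next
    fix x y assume xy: "x \<in> nichols_ideal C" "y \<in> nichols_ideal C"
    obtain f g where fg: "x = twist \<mu> f" "y = twist \<mu> g" by (metis twist_surj[OF mu_nz])
    have "x \<oplus>\<^bsub>?T\<^esub> y \<in> carrier ?T" using xy sub by blast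
    then show "x \<oplus>\<^bsub>?T\<^esub> y \<in> nichols_ideal C"
      using xy by (simp add: fg tensor_algebra_simps(5) twist_add[symmetric] twist_in_nichols_ideal_iff letter_product_add)
  qed (use sub in auto)
  fix x y assume xy: "x \<in> nichols_ideal C" "y \<in> carrier ?T"
  obtain f g where fg: "x = twist \<mu> f" "y = twist \<mu> g" by (metis twist_surj[OF mu_nz])
  have "x \<otimes>\<^bsub>?T\<^esub> y \<in> carrier ?T" "y \<otimes>\<^bsub>?T\<^esub> x \<in> carrier ?T" using xy sub by blast+
  moreover have "letter_product f = 0" using xy by (simp add: fg twist_in_nichols_ideal_iff)
  ultimately show "y \<otimes>\<^bsub>?T\<^esub> x \<in> nichols_ideal C" "x \<otimes>\<^bsub>?T\<^esub> y \<in> nichols_ideal C"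
    unfolding fg tensor_algebra_simps(2) by (auto intro: tmult_twist_in_nichols_ideal)
qed

text \<open>The witness is the twisted lift of \<open>real_root n\<close>, of degree
  \<open>2 * n + 1\<close>. A tensor of degree at most \<open>n\<close> contributes nothing at a
  word of that length, where \<open>real_root n\<close> is nonzero.\<close>

lemma not_bounded_degree_mod_nichols_ideal:
  assumes "b ^ 2 \<noteq> 1"
  shows "\<exists>f\<in>carrier tensor_algebra. \<forall>g. (\<forall>w. g w \<noteq> 0 \<longrightarrow> length w \<le> n) \<longrightarrow> f - g \<notin> nichols_ideal C"
proof -
  obtain t where t: "homogeneous (2 * n + 1) t" "letter_product t = real_root n"
    using real_root_tensor by blast
  let ?w = "V1 # concat (replicate n [V1, V2])"
  have len: "length ?w = 2 * n + 1" by (induction n) auto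
  have "finite {w :: idx list. length w = 2 * n + 1}"
    using finite_lists_length_eq[of "UNIV :: idx set" "2 * n + 1"] by simp
  then have "finite {w. twist \<mu> t w \<noteq> 0}"
    by (rule rev_finite_subset) (use t(1) in \<open>auto simp: homogeneous_def twist_def\<close>)
  then have "twist \<mu> t \<in> carrier tensor_algebra" by (simp add: tensor_algebra_simps)
  moreover have "twist \<mu> t - g \<notin> nichols_ideal C" if g: "\<forall>w. g w \<noteq> 0 \<longrightarrow> length w \<le> n" for g
  proof
    obtain h where h: "g = twist \<mu> h" by (rule twist_surj[OF mu_nz])
    assume "twist \<mu> t - g \<in> nichols_ideal C"
    then have "letter_product (t - h) = 0"
      by (simp add: h twist_diff[symmetric] twist_in_nichols_ideal_iff)
    then have "real_root n ?w = letter_product h ?w"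
      by (simp add: letter_product_diff t(2))
    moreover have "letter_product h ?w = 0"
    proof (rule letter_product_supported_0)
      fix v :: "idx list" assume "length v = length ?w"
      then have "length (alternate v) > n" using len by simp
      then have "g (alternate v) = 0" using g by (meson not_le)
      then show "h v = 0" using mu_nz by (simp add: h twist_def)
    qed
    ultimately show False using real_root_nonzero[OF assms(1)] by simp
  qed
  ultimately show ?thesis by blast
qed

end

section \<open>Finite-dimensional quotients of the tensor algebra\<close>

lemma carrier_FactRing: "carrier (R Quot I) = (\<lambda>x. I +>\<^bsub>R\<^esub> x) ` carrier R"
  unfolding FactRing_def A_RCOSETS_def' by (simp add: UNION_singleton_eq_range)

text \<open>Finitely many basis vectors have representatives of bounded degree, and multiplying by
  scalars and adding keeps the bound.\<close>

lemma finite_dimension_bounded_degree: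
  fixes J :: "('i list \<Rightarrow> 'k::field) set"
  assumes "ideal J tensor_algebra"
    and "ring.dimension (tensor_algebra Quot J) n (range (\<lambda>z. J +>\<^bsub>tensor_algebra\<^esub> scalar_tensor z)) E"
  shows "\<exists>N. \<forall>x\<in>E. \<exists>g\<in>carrier tensor_algebra. (\<forall>w. g w \<noteq> 0 \<longrightarrow> length w \<le> N) \<and> x = J +>\<^bsub>tensor_algebra\<^esub> g"
proof -
  let ?T = "tensor_algebra :: ('i list \<Rightarrow> 'k) ring"
  interpret ideal J ?T by fact
  interpret Q: ring "?T Quot J" by (rule quotient_is_ring)
  interpret h: ring_hom_ring ?T "?T Quot J" "(+>\<^bsub>?T\<^esub>) J" by (rule rcos_ring_hom_ring)
  have sc: "scalar_tensor z \<in> carrier ?T" for z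
    by (simp add: tensor_algebra_simps scalar_tensor_def)
  \<comment> \<open>The scalar set becomes a variable \<open>K\<close> with an equation, as required
    for rule induction on \<open>dimension\<close>.\<close>
  have "\<exists>N. \<forall>x\<in>E. \<exists>g\<in>carrier ?T. (\<forall>w. g w \<noteq> 0 \<longrightarrow> length w \<le> N) \<and> x = J +>\<^bsub>?T\<^esub> g"
    if "Q.dimension n K E" "K = range (\<lambda>z. J +>\<^bsub>?T\<^esub> scalar_tensor z)" for n K E
    using that
  proof (induction rule: Q.dimension.induct)
    case (zero_dim K)
    have "0 \<in> carrier ?T" "J +>\<^bsub>?T\<^esub> 0 = \<zero>\<^bsub>?T Quot J\<^esub>"
      using h.hom_zero by (simp_all add: tensor_algebra_simps)
    moreover have "\<forall>w :: 'i list. (0 :: 'i list \<Rightarrow> 'k) w \<noteq> 0 \<longrightarrow> length w \<le> 0" by simp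
    ultimately show ?case by blast
  next
    case (Suc_dim v E n K)
    obtain N where N: "\<forall>x\<in>E. \<exists>g\<in>carrier ?T. (\<forall>w. g w \<noteq> 0 \<longrightarrow> length w \<le> N) \<and> x = J +>\<^bsub>?T\<^esub> g"
      using Suc_dim.IH Suc_dim.prems by blast
    obtain u where u: "u \<in> carrier ?T" "v = J +>\<^bsub>?T\<^esub> u"
      using Suc_dim.hyps(1) unfolding carrier_FactRing by blast
    have "finite (length ` {w. u w \<noteq> 0})"
      using u(1) by (simp add: tensor_algebra_simps)
    then obtain M where M: "\<forall>w. u w \<noteq> 0 \<longrightarrow> length w \<le> M"
      by (auto simp: finite_nat_set_iff_bounded_le)
    have "\<exists>g\<in>carrier ?T. (\<forall>w. g w \<noteq> 0 \<longrightarrow> length w \<le> max M N) \<and> x = J +>\<^bsub>?T\<^esub> g"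
      if "x \<in> Q.line_extension K v E" for x
    proof -
      obtain k y where ky: "k \<in> K" "y \<in> E" "x = k \<otimes>\<^bsub>?T Quot J\<^esub> v \<oplus>\<^bsub>?T Quot J\<^esub> y"
        using \<open>x \<in> Q.line_extension K v E\<close>
        unfolding Q.line_extension_def set_add_def' r_coset_def by blast
      obtain z where z: "k = J +>\<^bsub>?T\<^esub> scalar_tensor z" using ky(1) Suc_dim.prems by blast
      obtain g where g: "g \<in> carrier ?T" "\<forall>w. g w \<noteq> 0 \<longrightarrow> length w \<le> N" "y = J +>\<^bsub>?T\<^esub> g"
        using N ky(2) by blast
      let ?g = "scalar_tensor z \<otimes>\<^bsub>?T\<^esub> u \<oplus>\<^bsub>?T\<^esub> g"
      have "x = J +>\<^bsub>?T\<^esub> ?g" using u g(1) sc by (simp add: ky(3) z g(3))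
      moreover have "?g \<in> carrier ?T" using u g(1) sc by blast
      moreover have "?g w = z * u w + g w" for w
        unfolding tensor_algebra_simps tmult_scalar_left by simp
      then have "u w \<noteq> 0 \<or> g w \<noteq> 0" if "?g w \<noteq> 0" for w
        using that by force
      then have "\<forall>w. ?g w \<noteq> 0 \<longrightarrow> length w \<le> max M N"
        using M g(2) by (meson le_max_iff_disj)
      ultimately show ?thesis by blast
    qed
    then show ?case by blast
  qed
  then show ?thesis using assms(2) by blast
qed

theorem corollary4p15:
  fixes a b e :: "'k :: {alg_closed_field, field_char_0}" and n :: nat
  assumes "a \<noteq> 0" and "b \<noteq> 0" and "e \<noteq> 0"
    and "a * e \<noteq> b ^ 2" and "b ^ 2 = inverse (a * e)"
    and "n \<ge> 5" and "primitive_root_of_unity n b"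
  shows "nichols_infinite_dimensional (V_abe a b e)"
proof -
  obtain \<mu> where \<mu>: "\<mu> ^ 2 = a * b"
    using nth_root_exists[of 2 "a * b"] by auto
  interpret V_abe_affine b a e \<mu>
  proof
    show "a * e * b ^ 2 = 1" using assms(1,3,5) by (simp del: inverse_mult_distrib)
    show "\<mu> \<noteq> 0" using assms(1,2) \<mu> by auto
  qed (use assms(2) \<mu> in auto)
  let ?T = "tensor_algebra :: (idx list \<Rightarrow> 'k) ring"
  interpret J: ideal "nichols_ideal C" ?T by (rule ideal_nichols_ideal)
  interpret Q: ring "nichols_algebra C" unfolding nichols_algebra_def by (rule J.quotient_is_ring)
  \<comment> \<open>The order of \<open>b\<close> is at least 5, hence greater than 2.\<close>
  have b2: "b ^ 2 \<noteq> 1"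
    using assms(6,7) unfolding primitive_root_of_unity_def by auto
  show ?thesis
    unfolding nichols_infinite_dimensional_def
  proof
    \<comment> \<open>Finite dimension would give every class a representative of degree at most
      some \<open>N\<close>, which fails for a real root vector of large degree.\<close>
    assume "Q.finite_dimension (nichols_scalars C) (carrier (nichols_algebra C))"
    then obtain m where "Q.dimension m (nichols_scalars C) (carrier (nichols_algebra C))"
      unfolding Q.finite_dimension_def by blast
    then have "ring.dimension (?T Quot nichols_ideal C) m
        (range (\<lambda>z. nichols_ideal C +>\<^bsub>?T\<^esub> scalar_tensor z)) (carrier (?T Quot nichols_ideal C))"
      unfolding nichols_scalars_def nichols_algebra_def .
    from finite_dimension_bounded_degree[OF ideal_nichols_ideal this]
    obtain N where N: "\<And>x. x \<in> carrier (?T Quot nichols_ideal C) \<Longrightarrow>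
        \<exists>g\<in>carrier ?T. (\<forall>w. g w \<noteq> 0 \<longrightarrow> length w \<le> N) \<and> x = nichols_ideal C +>\<^bsub>?T\<^esub> g"
      by blast
    obtain f where f: "f \<in> carrier ?T"
      "\<And>g. \<forall>w. g w \<noteq> 0 \<longrightarrow> length w \<le> N \<Longrightarrow> f - g \<notin> nichols_ideal C"
      using not_bounded_degree_mod_nichols_ideal[OF b2, of N] by blast
    have "nichols_ideal C +>\<^bsub>?T\<^esub> f \<in> carrier (?T Quot nichols_ideal C)"
      using f(1) unfolding carrier_FactRing by blast
    then obtain g where g: "g \<in> carrier ?T" "\<forall>w. g w \<noteq> 0 \<longrightarrow> length w \<le> N"
      "nichols_ideal C +>\<^bsub>?T\<^esub> f = nichols_ideal C +>\<^bsub>?T\<^esub> g"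
      using N by blast
    have "\<ominus>\<^bsub>?T\<^esub> g = - g"
      using g(1) by (intro J.minus_equality) (auto simp: tensor_algebra_simps)
    then have "f - g = f \<ominus>\<^bsub>?T\<^esub> g"
      by (simp add: a_minus_def tensor_algebra_simps(5))
    also have "\<dots> \<in> nichols_ideal C"
      using J.quotient_eq_iff_same_a_r_cos[OF ideal_nichols_ideal f(1) g(1)] g(3) by simp
    finally show False using f(2) g(2) by blast
  qed
qed

end
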